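(* Let $a,r,l,h>0$ and $$I=\inf_{(\mu,\rho)}\int_{\mathbb R\times\mathbb R}(rx^2+lu^2)\,\mu(dx,du)+\int_{\mathbb R\times\{\pm1\}\times[0,\infty)}h|\gamma|\,\rho(dx,d\gamma,d\delta),$$ where the infimum is over Borel probability measures $\mu$ on $\mathbb R\times\mathbb R$ and finite nonnegative Borel measures $\rho$ on $\mathbb R\times\{\pm1\}\times[0,\infty)$ satisfying $$\int_{\mathbb R\times\mathbb R}\big(\tfrac12af''(x)+uf'(x)\big)\mu(dx,du)+\int_{\mathbb R\times\{\pm1\}\times[0,\infty)}\gamma f'(x)\,\rho(dx,d\gamma,d\delta)=0\quad\text{for all }f\in C^2_0(\mathbb R).$$ Let $\iota\in(0,1)$, $U>0$ and $w$ be as described in the context and $u^*(x)=-\frac{w'(x)}{2l}$. Then $$I=\iota a\sqrt{rl},$$ and the optimum is attained by $(\mu^*,\rho^* )$, where $$\mu^*(dx,du)=p^*(x)\,dx\otimes\delta_{u^*(x)}(du),\qquad\rho^*=\rho^*_-\,\delta_{(-U,1,0)}+\rho^*_+\,\delta_{(U,-1,0)},$$ with $p^*\in C^2([-U,U])$ (extended by $0$ outside $[-U,U]$) solution of $$\begin{cases}\tfrac12ap''(x)-(u^*(x)p(x))'=0,&x\in(-U,U),\\ \tfrac12ap'(x)-u^*(x)p(x)=0,&x\in\{-U,U\},\\ \int_{-U}^Up(x)\,dx=1,\end{cases}$$ and $\rho^*_-=\tfrac12ap^*(-U)$, $\rho^*_+=\tfrac12ap^*(U)$.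
   Context: $C^2_0(\mathbb R)$ is the set of twice continuously differentiable compactly supported functions; $\delta_y$ is the Dirac mass at $y$; ${}_1F_1(\alpha;b;z)=\sum_{n\ge0}\frac{(\alpha)_n}{(b)_n}\frac{z^n}{n!}$ is the Kummer confluent hypergeometric function, with $(\cdot)_n$ the Pochhammer symbol. The numbers $\iota\in(0,1)$, $U>0$ and the even function $w:\mathbb R\to\mathbb R$ are such that $$w(x)=\begin{cases}(rl)^{1/2}x^2-2al\ln{}_1F_1\Big(\frac{1-\iota}4;\frac12;\big(\frac r{a^2l}\big)^{1/2}x^2\Big),&|x|\le U,\\ w(U)+h(|x|-U),&|x|>U,\end{cases}$$ with $w'(U)=\max_{[0,U]}w'=h$, $w''(U)=0$ and $0<w'(x)<h$ for $0<x<U$. *)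

theory Defs
  imports "HOL-Probability.Probability"
begin

definition kummer_1F1 :: "real \<Rightarrow> real \<Rightarrow> real \<Rightarrow> real" where
  "kummer_1F1 \<alpha> b z = (\<Sum>n. pochhammer \<alpha> n / pochhammer b n * (z ^ n / fact n))"

definition C2_0 :: "(real \<Rightarrow> real) set" where
  "C2_0 = {f. (\<forall>x. f field_differentiable (at x)) \<and>
              (\<forall>x. deriv f field_differentiable (at x)) \<and>
              continuous_on UNIV (deriv (deriv f)) \<and>
              compact (closure {x. f x \<noteq> 0})}"

text \<open>The Borel space of triples \<open>(x, \<gamma>, \<delta>)\<close>, with the \<open>\<sigma>\<close>-algebra induced from \<open>\<real>\<^sup>3\<close>.\<close>

definition jump_space :: "(real \<times> real \<times> real) measure" where
  "jump_space = restrict_space borel (UNIV \<times> {-1, 1} \<times> {0..})"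

text \<open>Integrability is part of the constraint because the Bochner integral of a non-integrable
  function is 0 by convention. It can only fail for \<open>u f'(x)\<close>, in which case
  \<open>\<integral> u\<^sup>2 d\<mu>\<close> and hence the cost below are infinite.\<close>

definition admissible ::
  "real \<Rightarrow> ((real \<times> real) measure \<times> (real \<times> real \<times> real) measure) set" where
  "admissible a = {(\<mu>, \<rho>).
     prob_space \<mu> \<and> sets \<mu> = sets borel \<and>
     finite_measure \<rho> \<and> sets \<rho> = sets jump_space \<and>
     (\<forall>f\<in>C2_0.
        integrable \<mu> (\<lambda>(x, u). 1/2 * a * deriv (deriv f) x + u * deriv f x) \<and>
        integrable \<rho> (\<lambda>(x, \<gamma>, \<delta>). \<gamma> * deriv f x) \<and>
        (\<integral>(x, u). 1/2 * a * deriv (deriv f) x + u * deriv f x \<partial>\<mu>)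
          + (\<integral>(x, \<gamma>, \<delta>). \<gamma> * deriv f x \<partial>\<rho>) = 0)}"

definition cost :: "real \<Rightarrow> real \<Rightarrow> real \<Rightarrow>
    (real \<times> real) measure \<Rightarrow> (real \<times> real \<times> real) measure \<Rightarrow> ennreal" where
  "cost r l h \<mu> \<rho> =
     (\<integral>\<^sup>+(x, u). ennreal (r * x\<^sup>2 + l * u\<^sup>2) \<partial>\<mu>) + (\<integral>\<^sup>+(x, \<gamma>, \<delta>). ennreal (h * \<bar>\<gamma>\<bar>) \<partial>\<rho>)"

definition optimal_cost :: "real \<Rightarrow> real \<Rightarrow> real \<Rightarrow> real \<Rightarrow> ennreal" where
  "optimal_cost a r l h = (INF (\<mu>, \<rho>)\<in>admissible a. cost r l h \<mu> \<rho>)"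

text \<open>Only the values of \<open>p\<close> on \<open>[-U, U]\<close> matter; its derivatives at \<open>\<plusminus>U\<close> are one-sided.\<close>

definition stationary_density ::
  "real \<Rightarrow> real \<Rightarrow> (real \<Rightarrow> real) \<Rightarrow> (real \<Rightarrow> real) \<Rightarrow> bool" where
  "stationary_density a U u p \<longleftrightarrow> (\<exists>p' p''.
     (\<forall>x\<in>{-U..U}. (p has_real_derivative p' x) (at x within {-U..U})) \<and>
     (\<forall>x\<in>{-U..U}. (p' has_real_derivative p'' x) (at x within {-U..U})) \<and>
     continuous_on {-U..U} p'' \<and>
     (\<forall>x\<in>{-U<..<U}. 1/2 * a * p'' x - deriv (\<lambda>y. u y * p y) x = 0) \<and>
     (\<forall>x\<in>{-U, U}. 1/2 * a * p' x - u x * p x = 0) \<and>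
     (p has_integral 1) {-U..U})"

text \<open>\<open>p(x) dx \<otimes> \<delta>\<^bsub>u(x)\<^esub>(du)\<close> is the image of \<open>p(x) dx\<close> under \<open>x \<mapsto> (x, u(x))\<close>;
  the indicator extends \<open>p\<close> by 0.\<close>

definition mu_star ::
  "real \<Rightarrow> (real \<Rightarrow> real) \<Rightarrow> (real \<Rightarrow> real) \<Rightarrow> (real \<times> real) measure" where
  "mu_star U u p =
     distr (density lborel (\<lambda>x. ennreal (indicator {-U..U} x * p x))) borel (\<lambda>x. (x, u x))"

definition rho_star :: "real \<Rightarrow> real \<Rightarrow> (real \<Rightarrow> real) \<Rightarrow> (real \<times> real \<times> real) measure" where
  "rho_star a U p = measure_of (space jump_space) (sets jump_space)
     (\<lambda>A. ennreal (1/2 * a * p (-U)) * indicator A (-U, 1, 0)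
        + ennreal (1/2 * a * p U) * indicator A (U, -1, 0))"

end

theory Submission
  imports Defs
begin

text \<open>The formula for \<open>w\<close> is \<open>-2 a l\<close> times the logarithm of
  \<open>\<phi>(x) = exp (-c x\<^sup>2 / 2) 1F1(c x\<^sup>2)\<close> with \<open>c = \<surd>(r / (a\<^sup>2 l))\<close>. Kummer's equation makes \<open>\<phi>\<close> an
  eigenfunction of a harmonic oscillator, so that \<open>w\<close> solves
  \<open>a w'' / 2 - w'\<^sup>2 / (4 l) + r x\<^sup>2 = I\<close> on \<open>[-U, U]\<close> with \<open>I = \<iota> a \<surd>(r l)\<close>. The conditions at \<open>U\<close> make
  \<open>w\<close> twice continuously differentiable, and outside \<open>[-U, U]\<close> the equation becomes the inequality
  \<open>\<ge> I\<close> because \<open>x\<^sup>2 > U\<^sup>2\<close>. Minimising over \<open>u\<close>, the pointwise bounds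
  \<open>r x\<^sup>2 + l u\<^sup>2 \<ge> I - (a w'' / 2 + u w')\<close> and \<open>h \<bar>\<gamma>\<bar> \<ge> - \<gamma> w'\<close> hold. If the cost is finite, \<open>u\<close> is
  \<open>\<mu>\<close>-integrable, and cutting off \<open>w\<close> shows that the linear constraint also holds for \<open>f = w\<close>. Integrating
  gives the lower bound \<open>I\<close>. Equality holds for \<open>u = - w' / (2 l)\<close> on \<open>[-U, U]\<close> with jumps at \<open>\<plusminus>U\<close>, by the
  fundamental theorem of calculus, since the stationary density satisfies the zero-flux equation
  \<open>a p' / 2 = u p\<close> on the whole interval.\<close>

section \<open>The Kummer function\<close>

text \<open>For \<open>0 < \<alpha> \<le> b\<close> every quotient of Pochhammer symbols lies in
  [0, 1], so the exponential series dominates. Raising both parameters by one preserves the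
  condition, hence the derivatives are covered too.\<close>

lemma sums_kummer_1F1:
  assumes "0 < \<alpha>" "\<alpha> \<le> b"
  shows "(\<lambda>n. pochhammer \<alpha> n / pochhammer b n / fact n * z ^ n) sums kummer_1F1 \<alpha> b z"
proof -
  have nonneg: "0 \<le> pochhammer \<alpha> n" "0 < pochhammer b n" for n
    using assms by (auto intro!: pochhammer_nonneg pochhammer_pos)
  have "pochhammer \<alpha> n \<le> pochhammer b n" for n
    using assms unfolding pochhammer_prod by (intro prod_mono) auto
  then have "\<bar>pochhammer \<alpha> n / pochhammer b n\<bar> \<le> 1" for n
    using nonneg[of n] by simp
  then have "norm (pochhammer \<alpha> n / pochhammer b n * (z ^ n / fact n)) \<le> norm (z ^ n / fact n)" for n
    unfolding norm_mult by (intro mult_left_le_one_le) auto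
  moreover have "summable (\<lambda>n. norm (z ^ n / fact n))"
    using summable_norm_exp[of z] by (simp add: field_simps)
  ultimately have "summable (\<lambda>n. pochhammer \<alpha> n / pochhammer b n * (z ^ n / fact n))"
    by (rule summable_comparison_test'[of "\<lambda>n. norm (z ^ n / fact n)" 0, rotated])
  then have "(\<lambda>n. pochhammer \<alpha> n / pochhammer b n * (z ^ n / fact n)) sums kummer_1F1 \<alpha> b z"
    unfolding kummer_1F1_def by (rule summable_sums)
  moreover have "x * (y / f) = x / f * y" for x y f :: real
    by simp
  ultimately show ?thesis
    by simp
qed

text \<open>Since \<open>(\<alpha>)_(n+1) = \<alpha> (\<alpha>+1)_n\<close>, the differentiated
  series is, up to the factor \<open>\<alpha> / b\<close>, the one with both parameters raised by
  one.\<close>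

lemma kummer_1F1_coeff_Suc:
  fixes \<alpha> b :: real
  shows "real (Suc n) * (pochhammer \<alpha> (Suc n) / pochhammer b (Suc n) / fact (Suc n))
    = \<alpha> / b * (pochhammer (\<alpha> + 1) n / pochhammer (b + 1) n / fact n)"
proof -
  have "x * (A / B / (x * F)) = A / B / F" if "x \<noteq> 0" for x A B F :: real
    using that by (simp add: divide_simps)
  from this[of "real (Suc n)"] show ?thesis
    by (simp add: pochhammer_rec del: of_nat_Suc)
qed

lemma has_real_derivative_kummer_1F1:
  assumes "0 < \<alpha>" "\<alpha> \<le> b"
  shows "(kummer_1F1 \<alpha> b has_real_derivative \<alpha> / b * kummer_1F1 (\<alpha> + 1) (b + 1) z) (at z)"
proof -
  define c where "c = (\<lambda>n. pochhammer \<alpha> n / pochhammer b n / fact n)"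
  have sums: "(\<lambda>n. c n * x ^ n) sums kummer_1F1 \<alpha> b x" for x
    unfolding c_def using assms by (rule sums_kummer_1F1)
  have diffs: "diffs c n = \<alpha> / b * (pochhammer (\<alpha> + 1) n / pochhammer (b + 1) n / fact n)" for n
    unfolding diffs_def c_def by (rule kummer_1F1_coeff_Suc)
  have "(\<lambda>n. diffs c n * z ^ n) sums (\<alpha> / b * kummer_1F1 (\<alpha> + 1) (b + 1) z)"
    using sums_mult[OF sums_kummer_1F1[of "\<alpha> + 1" "b + 1" z], of "\<alpha> / b"] assms
    unfolding diffs by (simp add: mult.assoc)
  moreover have "((\<lambda>x. \<Sum>n. c n * x ^ n) has_real_derivative (\<Sum>n. diffs c n * z ^ n)) (at z)"
    by (rule termdiffs_strong_converges_everywhere) (use sums in \<open>auto simp: sums_iff\<close>)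
  moreover have "(\<lambda>x. \<Sum>n. c n * x ^ n) = kummer_1F1 \<alpha> b"
    using sums by (auto simp: sums_iff)
  ultimately show ?thesis
    by (simp add: sums_iff)
qed

text \<open>All terms are nonnegative and the zeroth one is 1. This keeps the argument of the
  logarithm in the formula for \<open>w\<close> positive.\<close>

lemma kummer_1F1_pos:
  assumes "0 < \<alpha>" "\<alpha> \<le> b" "0 \<le> z"
  shows "0 < kummer_1F1 \<alpha> b z"
proof -
  have nonneg: "0 \<le> pochhammer \<alpha> n" "0 < pochhammer b n" for n
    using assms by (auto intro!: pochhammer_nonneg pochhammer_pos)
  have "0 \<le> pochhammer \<alpha> n / pochhammer b n / fact n * z ^ n" for n
    using nonneg[of n] \<open>0 \<le> z\<close> by simp
  with sums_kummer_1F1[OF assms(1,2), of z] show ?thesis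
    using suminf_pos2[of "\<lambda>n. pochhammer \<alpha> n / pochhammer b n / fact n * z ^ n" 0]
    unfolding sums_iff by simp
qed

text \<open>Kummer's equation \<open>z F'' + (b - z) F' = \<alpha> F\<close>, with the derivatives
  expressed through shifted parameters. Comparing coefficients of \<open>z ^ n\<close> reduces it to
  the two-term recursion \<open>rec\<close>.\<close>

lemma kummer_1F1_ode:
  assumes "0 < \<alpha>" "\<alpha> \<le> b"
  shows "z * (\<alpha> / b * ((\<alpha> + 1) / (b + 1) * kummer_1F1 (\<alpha> + 1 + 1) (b + 1 + 1) z))
    + (b - z) * (\<alpha> / b * kummer_1F1 (\<alpha> + 1) (b + 1) z) = \<alpha> * kummer_1F1 \<alpha> b z"
    (is "z * ?F2 + (b - z) * ?F1 = _")
proof -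
  define c where "c = (\<lambda>n. pochhammer \<alpha> n / pochhammer b n / fact n)"
  have c1: "real (Suc n) * c (Suc n)
      = \<alpha> / b * (pochhammer (\<alpha> + 1) n / pochhammer (b + 1) n / fact n)" for n
    unfolding c_def by (rule kummer_1F1_coeff_Suc)
  have c2: "real (Suc n) * (real (Suc (Suc n)) * c (Suc (Suc n)))
      = \<alpha> / b * ((\<alpha> + 1) / (b + 1) * (pochhammer (\<alpha> + 1 + 1) n / pochhammer (b + 1 + 1) n / fact n))" for n
    unfolding c1 by (subst mult.left_commute) (simp only: kummer_1F1_coeff_Suc)
  have rec: "(b + n) * (real (Suc n) * c (Suc n)) = (\<alpha> + n) * c n" for n
  proof -
    have "y * (x * (A * z / (B * y) / (x * F))) = z * (A / B / F)"
      if "x \<noteq> 0" "y \<noteq> 0" for x y z A B F :: real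
      using that by (simp add: divide_simps)
    from this[of "real (Suc n)" "b + n"] show ?thesis
      using assms by (simp add: c_def pochhammer_Suc del: of_nat_Suc)
  qed
  have sums0: "(\<lambda>n. c n * z ^ n) sums kummer_1F1 \<alpha> b z"
    unfolding c_def using assms by (rule sums_kummer_1F1)
  have sums1: "(\<lambda>n. real (Suc n) * c (Suc n) * z ^ n) sums ?F1"
    unfolding c1 mult.assoc using assms by (intro sums_mult sums_kummer_1F1) auto
  have sums2: "(\<lambda>n. real (Suc n) * (real (Suc (Suc n)) * c (Suc (Suc n))) * z ^ n) sums ?F2"
    unfolding c2 mult.assoc using assms by (intro sums_mult sums_kummer_1F1) auto
  have "(\<lambda>n. real (Suc n) * c (Suc n) * z ^ Suc n) sums (z * ?F1)"
    using sums_mult[OF sums1, of z] by (simp add: ac_simps)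
  \<comment> \<open>Multiplication by \<open>z\<close> shifts the index. The added zeroth term
    vanishes because of the factor \<open>n\<close>, so the sum is unchanged.\<close>
  then have sums1': "(\<lambda>n. n * c n * z ^ n) sums (z * ?F1)"
    by (subst (asm) sums_Suc_iff) simp
  have "(\<lambda>n. real (Suc n) * (real (Suc (Suc n)) * c (Suc (Suc n))) * z ^ Suc n) sums (z * ?F2)"
    using sums_mult[OF sums2, of z] by (simp add: ac_simps)
  then have sums2': "(\<lambda>n. n * (real (Suc n) * c (Suc n)) * z ^ n) sums (z * ?F2)"
    by (subst (asm) sums_Suc_iff) simp
  have "(\<lambda>n. n * (real (Suc n) * c (Suc n)) * z ^ n
      + (b * (real (Suc n) * c (Suc n) * z ^ n) - n * c n * z ^ n))
      sums (z * ?F2 + (b * ?F1 - z * ?F1))"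
    by (intro sums_add sums_diff sums_mult sums1 sums1' sums2')
  moreover have "(\<lambda>n. n * (real (Suc n) * c (Suc n)) * z ^ n
      + (b * (real (Suc n) * c (Suc n) * z ^ n) - n * c n * z ^ n)) = (\<lambda>n. \<alpha> * (c n * z ^ n))"
  proof
    fix n :: nat
    have "n * (real (Suc n) * c (Suc n)) * z ^ n
        + (b * (real (Suc n) * c (Suc n) * z ^ n) - n * c n * z ^ n)
        = ((b + n) * (real (Suc n) * c (Suc n)) - n * c n) * z ^ n"
      by (simp add: algebra_simps del: of_nat_Suc)
    also have "\<dots> = \<alpha> * (c n * z ^ n)"
      unfolding rec by (simp add: algebra_simps)
    finally show "n * (real (Suc n) * c (Suc n)) * z ^ n
      + (b * (real (Suc n) * c (Suc n) * z ^ n) - n * c n * z ^ n) = \<alpha> * (c n * z ^ n)" .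
  qed
  ultimately have "(\<lambda>n. \<alpha> * (c n * z ^ n)) sums (z * ?F2 + (b * ?F1 - z * ?F1))"
    by (simp only:)
  then have "z * ?F2 + (b * ?F1 - z * ?F1) = \<alpha> * kummer_1F1 \<alpha> b z"
    by (rule sums_unique2[OF _ sums_mult[OF sums0]])
  then show ?thesis
    by (simp only: left_diff_distrib)
qed

section \<open>The value function\<close>

text \<open>The logarithm turns the linear Kummer equation into a Riccati equation for
  \<open>W'\<close>. The formula is differentiated on the whole line, not only on
  \<open>[-U, U]\<close>, so that no one-sided derivatives occur before gluing.\<close>

lemma kummer_value_ode:
  fixes a r l \<iota> :: real
  assumes "a > 0" "r > 0" "l > 0" "0 < \<iota>" "\<iota> < 1"
  obtains W' W'' where
    "\<And>x. ((\<lambda>x. sqrt (r * l) * x\<^sup>2 - 2 * a * l *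
        ln (kummer_1F1 ((1 - \<iota>) / 4) (1/2) (sqrt (r / (a\<^sup>2 * l)) * x\<^sup>2)))
      has_real_derivative W' x) (at x)"
    "\<And>x. (W' has_real_derivative W'' x) (at x)"
    "continuous_on UNIV W''"
    "\<And>x. 1/2 * a * W'' x - (W' x)\<^sup>2 / (4 * l) + r * x\<^sup>2 = \<iota> * a * sqrt (r * l)"
proof -
  define s c \<alpha> where "s = sqrt (r * l)" and "c = sqrt (r / (a\<^sup>2 * l))" and "\<alpha> = (1 - \<iota>) / 4"
  \<comment> \<open>\<open>F1\<close> and \<open>F2\<close> are the first two derivatives of
    \<open>F0\<close>; all three are evaluated at \<open>c * x\<^sup>2\<close> below.\<close>
  define F0 where "F0 = kummer_1F1 \<alpha> (1/2)"
  define F1 where "F1 = (\<lambda>z. \<alpha> / (1/2) * kummer_1F1 (\<alpha> + 1) (1/2 + 1) z)"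
  define F2 where
    "F2 = (\<lambda>z. \<alpha> / (1/2) * ((\<alpha> + 1) / (1/2 + 1) * kummer_1F1 (\<alpha> + 1 + 1) (1/2 + 1 + 1) z))"
  have \<alpha>: "0 < \<alpha>" "\<alpha> \<le> 1/2"
    using assms by (auto simp: \<alpha>_def)
  have s_sq: "s\<^sup>2 = r * l"
    using assms by (simp add: s_def)
  have "s = sqrt ((a * l)\<^sup>2 * (r / (a\<^sup>2 * l)))"
    using assms by (simp add: s_def power2_eq_square)
  then have s_c: "s = a * l * c"
    using assms unfolding c_def real_sqrt_mult by simp
  have c: "0 \<le> c"
    using assms by (simp add: c_def)
  have F0_pos: "0 < F0 (c * x\<^sup>2)" for x
    unfolding F0_def using \<alpha> c by (intro kummer_1F1_pos) auto
  have dF0: "(F0 has_real_derivative F1 z) (at z)" for z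
    unfolding F0_def F1_def using \<alpha> by (intro has_real_derivative_kummer_1F1)
  have dF1: "(F1 has_real_derivative F2 z) (at z)" for z
    unfolding F1_def F2_def using \<alpha> by (intro DERIV_cmult has_real_derivative_kummer_1F1) auto
  have "(F2 has_real_derivative \<alpha> / (1/2) * ((\<alpha> + 1) / (1/2 + 1) *
      ((\<alpha> + 1 + 1) / (1/2 + 1 + 1) * kummer_1F1 (\<alpha> + 1 + 1 + 1) (1/2 + 1 + 1 + 1) z))) (at z)" for z
    unfolding F2_def using \<alpha> by (intro DERIV_cmult has_real_derivative_kummer_1F1) auto
  then have isCont: "isCont F0 z" "isCont F1 z" "isCont F2 z" for z
    using dF0 dF1 by (auto intro: DERIV_isCont)
  have ode: "z * F2 z + (1/2 - z) * F1 z = \<alpha> * F0 z" for z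
    unfolding F0_def F1_def F2_def using kummer_1F1_ode[OF \<alpha>] .
  define W' where "W' = (\<lambda>x. 2 * s * x - 2 * a * l * (F1 (c * x\<^sup>2) * (2 * c * x) / F0 (c * x\<^sup>2)))"
  define W'' where "W'' = (\<lambda>x. 2 * s - 2 * a * l *
     (((F2 (c * x\<^sup>2) * (2 * c * x) * (2 * c * x) + F1 (c * x\<^sup>2) * (2 * c)) * F0 (c * x\<^sup>2)
       - F1 (c * x\<^sup>2) * (2 * c * x) * (F1 (c * x\<^sup>2) * (2 * c * x))) / (F0 (c * x\<^sup>2) * F0 (c * x\<^sup>2))))"
  have inner: "((\<lambda>x. c * x\<^sup>2) has_real_derivative 2 * c * x) (at x)" for x
    by (auto intro!: derivative_eq_intros)
  note d0 = DERIV_chain2[OF dF0 inner] and d1 = DERIV_chain2[OF dF1 inner]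
  show ?thesis
  proof (rule that[of W' W''])
    fix x
    show "((\<lambda>x. sqrt (r * l) * x\<^sup>2 - 2 * a * l *
        ln (kummer_1F1 ((1 - \<iota>) / 4) (1/2) (sqrt (r / (a\<^sup>2 * l)) * x\<^sup>2)))
      has_real_derivative W' x) (at x)"
      unfolding s_def[symmetric] c_def[symmetric] \<alpha>_def[symmetric] F0_def[symmetric] W'_def
      using F0_pos[of x] by (auto intro!: derivative_eq_intros d0 simp: divide_inverse)
    have lin: "((\<lambda>x. 2 * c * x) has_real_derivative 2 * c) (at x)"
      by (auto intro!: derivative_eq_intros)
    have "((\<lambda>x. F1 (c * x\<^sup>2) * (2 * c * x)) has_real_derivative
        F1 (c * x\<^sup>2) * (2 * c) + F2 (c * x\<^sup>2) * (2 * c * x) * (2 * c * x)) (at x)"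
      by (rule DERIV_mult'[OF d1 lin])
    then have "((\<lambda>x. F1 (c * x\<^sup>2) * (2 * c * x) / F0 (c * x\<^sup>2)) has_real_derivative
       ((F1 (c * x\<^sup>2) * (2 * c) + F2 (c * x\<^sup>2) * (2 * c * x) * (2 * c * x)) * F0 (c * x\<^sup>2)
        - F1 (c * x\<^sup>2) * (2 * c * x) * (F1 (c * x\<^sup>2) * (2 * c * x))) / (F0 (c * x\<^sup>2) * F0 (c * x\<^sup>2))) (at x)"
      using F0_pos[of x] by (intro DERIV_divide d0) auto
    then have "(W' has_real_derivative 2 * s - 2 * a * l *
       (((F1 (c * x\<^sup>2) * (2 * c) + F2 (c * x\<^sup>2) * (2 * c * x) * (2 * c * x)) * F0 (c * x\<^sup>2)
        - F1 (c * x\<^sup>2) * (2 * c * x) * (F1 (c * x\<^sup>2) * (2 * c * x))) / (F0 (c * x\<^sup>2) * F0 (c * x\<^sup>2)))) (at x)"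
      unfolding W'_def by (intro DERIV_diff DERIV_cmult) (auto intro!: derivative_eq_intros)
    then show "(W' has_real_derivative W'' x) (at x)"
      unfolding W''_def by (simp only: add.commute)
    have "isCont W'' x" for x
      unfolding W''_def using F0_pos[of x]
      by (intro continuous_intros isCont_o2[OF _ isCont(1)] isCont_o2[OF _ isCont(2)]
          isCont_o2[OF _ isCont(3)]) auto
    then show "continuous_on UNIV W''"
      by (simp add: continuous_at_imp_continuous_on)
    \<comment> \<open>Dividing Kummer's equation by \<open>F0\<close> gives a linear relation
      between \<open>P\<close> and \<open>Q\<close>. With \<open>Q\<close> eliminated,
      \<open>W'\<close> is affine in \<open>P\<close>, and the terms in \<open>P - P\<^sup>2\<close>
      coming from \<open>W''\<close> and from the square of \<open>W'\<close> cancel.\<close>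
    define P Q where "P = F1 (c * x\<^sup>2) / F0 (c * x\<^sup>2)" and "Q = F2 (c * x\<^sup>2) / F0 (c * x\<^sup>2)"
    have F: "F1 (c * x\<^sup>2) = P * F0 (c * x\<^sup>2)" "F2 (c * x\<^sup>2) = Q * F0 (c * x\<^sup>2)"
      using F0_pos[of x] by (auto simp: P_def Q_def)
    have "(c * x\<^sup>2 * Q + (1/2 - c * x\<^sup>2) * P) * F0 (c * x\<^sup>2) = \<alpha> * F0 (c * x\<^sup>2)"
      using ode[of "c * x\<^sup>2"] unfolding F by (simp only: distrib_right mult.assoc)
    then have PQ: "c * x\<^sup>2 * Q + (1/2 - c * x\<^sup>2) * P = \<alpha>"
      using F0_pos[of x] by simp
    have W'_eq: "W' x = 2 * s * x - 4 * s * x * P"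
      using F0_pos[of x] unfolding W'_def F s_c by simp
    have "W'' x = 2 * s - 2 * a * l * (4 * c * (c * x\<^sup>2 * Q) + 2 * c * P - 4 * c * c * x\<^sup>2 * P\<^sup>2)"
    proof -
      have "((Q * f * (2 * c * x) * (2 * c * x) + P * f * (2 * c)) * f
        - P * f * (2 * c * x) * (P * f * (2 * c * x))) / (f * f)
        = 4 * c * (c * x\<^sup>2 * Q) + 2 * c * P - 4 * c * c * x\<^sup>2 * P\<^sup>2" if "f > 0" for f
        using that by (simp add: divide_simps) (simp add: algebra_simps power2_eq_square)
      from this[OF F0_pos] show ?thesis
        unfolding W''_def F by simp
    qed
    also have "c * x\<^sup>2 * Q = \<alpha> - (1/2 - c * x\<^sup>2) * P"
      using PQ by simp
    also have "2 * s - 2 * a * l * (4 * c * (\<alpha> - (1/2 - c * x\<^sup>2) * P) + 2 * c * P - 4 * c * c * x\<^sup>2 * P\<^sup>2)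
       = 2 * s - 8 * (a * l * c) * \<alpha> - 8 * (a * l * c) * c * x\<^sup>2 * P + 8 * (a * l * c) * c * x\<^sup>2 * P\<^sup>2"
      by (simp add: algebra_simps)
    \<comment> \<open>The choice \<open>\<alpha> = (1 - \<iota>) / 4\<close> makes
      \<open>2 * s - 8 * s * \<alpha>\<close> equal to \<open>2 * s * \<iota>\<close>, the source of
      the constant in the equation.\<close>
    also have "\<dots> = 2 * s * \<iota> - 8 * s * c * x\<^sup>2 * (P - P\<^sup>2)"
      unfolding s_c[symmetric] \<alpha>_def by (simp add: field_simps)
    finally have W''_eq: "W'' x = 2 * s * \<iota> - 8 * s * c * x\<^sup>2 * (P - P\<^sup>2)" .
    have "1/2 * a * W'' x = \<iota> * a * s - 4 * (a * c * s) * x\<^sup>2 * (P - P\<^sup>2)"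
      unfolding W''_eq by (simp add: algebra_simps)
    moreover have "(W' x)\<^sup>2 / (4 * l) = s\<^sup>2 * x\<^sup>2 * (1 - 4 * (P - P\<^sup>2)) / l"
      using assms unfolding W'_eq by (simp add: divide_simps) (simp add: power2_eq_square algebra_simps)
    moreover have "a * c * s = r"
    proof -
      have "l * (a * c * s) = l * r"
        using s_sq unfolding s_c by (simp add: power2_eq_square ac_simps)
      then show ?thesis using assms by simp
    qed
    moreover have "s\<^sup>2 * x\<^sup>2 * (1 - 4 * (P - P\<^sup>2)) / l = r * x\<^sup>2 * (1 - 4 * (P - P\<^sup>2))"
      using assms unfolding s_sq by simp
    ultimately show "1/2 * a * W'' x - (W' x)\<^sup>2 / (4 * l) + r * x\<^sup>2 = \<iota> * a * sqrt (r * l)"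
      unfolding s_def[symmetric] by (simp only:) (simp add: algebra_simps)
  qed
qed

section \<open>Gluing the value function at \<plusminus>U\<close>

text \<open>\<open>W\<close> is the inner formula extended to the line. The two-sided derivatives
  assumed at \<open>U\<close> must agree with those of \<open>W\<close> from the left, which forces
  \<open>W'' U = 0\<close>; evenness carries this to \<open>-U\<close>, so the glued second
  derivative is continuous.\<close>

lemma glued_value_C2:
  fixes w W W' W'' :: "real \<Rightarrow> real"
  assumes "U > 0"
    and even: "\<And>x. w (- x) = w x"
    and inner: "\<And>x. \<bar>x\<bar> \<le> U \<Longrightarrow> w x = W x"
    and outer: "\<And>x. \<bar>x\<bar> > U \<Longrightarrow> w x = w U + h * (\<bar>x\<bar> - U)"
    and dW: "\<And>x. (W has_real_derivative W' x) (at x)" "\<And>x. (W' has_real_derivative W'' x) (at x)"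
    and contW: "continuous_on UNIV W''"
    and dU: "(w has_real_derivative h) (at U)" "(deriv w has_real_derivative 0) (at U)"
  defines "w'' \<equiv> \<lambda>x. if \<bar>x\<bar> \<le> U then W'' x else 0"
  shows "\<And>x. (w has_real_derivative deriv w x) (at x)"
    and "\<And>x. (deriv w has_real_derivative w'' x) (at x)"
    and "continuous_on UNIV w''"
    and "\<And>x. \<bar>x\<bar> \<le> U \<Longrightarrow> deriv w x = W' x"
    and "\<And>x. \<bar>x\<bar> \<ge> U \<Longrightarrow> deriv w x = h * sgn x"
    and "\<And>x. deriv w (- x) = - deriv w x"
    and "W'' U = 0" "W'' (- U) = 0"
proof -
  have in_d: "(w has_real_derivative W' x) (at x)" if "\<bar>x\<bar> < U" for x
    using dW(1)[of x] by (rule has_field_derivative_transform_within_open[of _ _ _ "{-U<..<U}"])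
      (use that inner in auto)
  have lin_r: "((\<lambda>x. w U + h * (x - U)) has_real_derivative h) (at x)" for x
    by (auto intro!: derivative_eq_intros)
  have right: "(w has_real_derivative h) (at x)" if "x \<ge> U" for x
  proof (cases "x = U")
    case False
    show ?thesis
      using lin_r by (rule has_field_derivative_transform_within_open[of _ _ _ "{U<..}"])
        (use that False outer \<open>U > 0\<close> in auto)
  qed (use dU in auto)
  have mirror: "(w has_real_derivative - d) (at (- x))" if "(w has_real_derivative d) (at x)" for x d
    unfolding DERIV_mirror even minus_minus by (rule that)
  have left: "(w has_real_derivative - h) (at x)" if "x \<le> - U" for x
    using mirror[OF right[of "- x"]] that by simp
  show dw: "(w has_real_derivative deriv w x) (at x)" for x
    using in_d[of x] right[of x] left[of x] DERIV_deriv_iff_real_differentiable real_differentiable_def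
    by (cases "\<bar>x\<bar> < U"; cases "x \<ge> 0") (auto dest: DERIV_imp_deriv)
  show odd: "deriv w (- x) = - deriv w x" for x
    using mirror[OF dw] by (rule DERIV_imp_deriv)
  show out: "deriv w x = h * sgn x" if "\<bar>x\<bar> \<ge> U" for x
    using that right[THEN DERIV_imp_deriv, of x] left[THEN DERIV_imp_deriv, of x] \<open>U > 0\<close>
    by (cases "x \<ge> 0") (auto simp: abs_if sgn_if)
  \<comment> \<open>All points of \<open>[-U, U]\<close>, endpoints included, are limit points of
    it, so derivatives within the interval are unique. This is how one-sided information is compared
    at \<plusminus>U.\<close>
  have nontriv: "at x within {- U..U} \<noteq> bot" if "\<bar>x\<bar> \<le> U" for x
    using that \<open>U > 0\<close> by (auto simp: trivial_limit_within islimpt_Icc)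
  show ind: "deriv w x = W' x" if "\<bar>x\<bar> \<le> U" for x
  proof (rule has_field_derivative_unique[OF _ _ nontriv[OF that]])
    show "(w has_real_derivative deriv w x) (at x within {- U..U})"
      using dw by (rule has_field_derivative_at_within)
    show "(w has_real_derivative W' x) (at x within {- U..U})"
      using has_field_derivative_at_within[OF dW(1), of x]
      by (rule has_field_derivative_transform_within[OF _ zero_less_one]) (use that inner in auto)
  qed
  have mirror': "(deriv w has_real_derivative d) (at (- x))"
    if "(deriv w has_real_derivative d) (at x)" for x d
    unfolding DERIV_mirror odd using that by (rule DERIV_minus)
  have ind2: "d = W'' x" if "\<bar>x\<bar> \<le> U" "(deriv w has_real_derivative d) (at x)" for x d
  proof (rule has_field_derivative_unique[OF _ _ nontriv[OF that(1)]])
    show "(deriv w has_real_derivative d) (at x within {- U..U})"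
      using that(2) by (rule has_field_derivative_at_within)
    show "(deriv w has_real_derivative W'' x) (at x within {- U..U})"
      using has_field_derivative_at_within[OF dW(2), of x]
      by (rule has_field_derivative_transform_within[OF _ zero_less_one]) (use that ind in auto)
  qed
  show W''_U: "W'' U = 0" "W'' (- U) = 0"
    using ind2[OF _ dU(2)] ind2[OF _ mirror'[OF dU(2)]] \<open>U > 0\<close> by auto
  show "(deriv w has_real_derivative w'' x) (at x)" for x
  proof -
    consider "\<bar>x\<bar> < U" | "x = U" | "x = - U" | "x > U" | "x < - U"
      by linarith
    then show ?thesis
    proof cases
      case 1
      have "(deriv w has_real_derivative W'' x) (at x)"
        using dW(2)[of x] by (rule has_field_derivative_transform_within_open[of _ _ _ "{-U<..<U}"])
          (use 1 ind in auto)
      with 1 show ?thesis by (simp add: w''_def)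
    next
      case 4
      have "(deriv w has_real_derivative 0) (at x)"
        using DERIV_const by (rule has_field_derivative_transform_within_open[of "\<lambda>_. h" _ _ "{U<..}"])
          (use 4 out \<open>U > 0\<close> in auto)
      with 4 \<open>U > 0\<close> show ?thesis by (simp add: w''_def)
    next
      case 5
      have "(deriv w has_real_derivative 0) (at x)"
        using DERIV_const by (rule has_field_derivative_transform_within_open[of "\<lambda>_. - h" _ _ "{..<-U}"])
          (use 5 out \<open>U > 0\<close> in auto)
      with 5 \<open>U > 0\<close> show ?thesis by (simp add: w''_def)
    qed (use dU(2) mirror'[OF dU(2)] W''_U \<open>U > 0\<close> in \<open>auto simp: w''_def\<close>)
  qed
  \<comment> \<open>The closed pieces meet only at \<plusminus>U, where \<open>W''\<close>
    vanishes.\<close>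
  have "continuous_on ({-U..U} \<union> ({..-U} \<union> {U..})) w''"
    unfolding w''_def
  proof (rule continuous_on_cases)
    show "continuous_on {-U..U} W''"
      using contW by (rule continuous_on_subset) auto
    show "\<forall>x. x \<in> {-U..U} \<and> \<not> \<bar>x\<bar> \<le> U \<or> x \<in> {..-U} \<union> {U..} \<and> \<bar>x\<bar> \<le> U \<longrightarrow> W'' x = 0"
      using W''_U by (auto simp: abs_le_iff) (metis W''_U order_antisym minus_le_iff)+
  qed auto
  moreover have "{-U..U} \<union> ({..-U} \<union> {U..}) = (UNIV :: real set)"
    by auto
  ultimately show "continuous_on UNIV w''"
    by simp
qed

section \<open>The lower bound\<close>

text \<open>With exponent at least 2 the kink at 0 disappears: there \<open>max 0 z ^ k\<close> is a
  continuous slope function for Caratheodory's criterion, with value 0.\<close>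

lemma has_real_derivative_max_0_power:
  fixes t :: real
  assumes "k \<noteq> 0"
  shows "((\<lambda>t. max 0 t ^ Suc k) has_real_derivative Suc k * max 0 t ^ k) (at t)"
proof -
  consider "t < 0" | "t = 0" | "t > 0" by linarith
  then show ?thesis
  proof cases
    case 1
    then have "Suc k * max 0 t ^ k = 0"
      using assms by simp
    then have "((\<lambda>t::real. 0) has_real_derivative Suc k * max 0 t ^ k) (at t)"
      by (simp only: DERIV_const)
    then show ?thesis
      by (rule has_field_derivative_transform_within_open[of _ _ _ "{..<0}"]) (use 1 in auto)
  next
    case 2
    have "max 0 z ^ Suc k - max 0 0 ^ Suc k = max 0 z ^ k * (z - 0)" for z :: real
      using assms by (simp add: max_def)
    moreover have "isCont (\<lambda>z::real. max 0 z ^ k) 0"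
      by (intro continuous_intros)
    ultimately show ?thesis
      unfolding 2 CARAT_DERIV using assms
      by (intro exI[of _ "\<lambda>z. max 0 z ^ k"]) auto
  next
    case 3
    have "((\<lambda>t. t ^ Suc k) has_real_derivative Suc k * max 0 t ^ k) (at t)"
      using 3 DERIV_pow[of "Suc k" t UNIV] by simp
    then show ?thesis
      by (rule has_field_derivative_transform_within_open[of _ _ _ "{0<..}"]) (use 3 in auto)
  qed
qed

lemma C2_bump:
  obtains b b' b'' :: "real \<Rightarrow> real" where
    "\<And>y. (b has_real_derivative b' y) (at y)" "\<And>y. (b' has_real_derivative b'' y) (at y)"
    "continuous_on UNIV b''" "b 0 = 1" "\<And>y. \<bar>y\<bar> \<ge> 1 \<Longrightarrow> b y = 0 \<and> b' y = 0 \<and> b'' y = 0"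
    "\<And>y. \<bar>b y\<bar> \<le> 30 \<and> \<bar>b' y\<bar> \<le> 30 \<and> \<bar>b'' y\<bar> \<le> 30"
proof -
  define m where "m = (\<lambda>y::real. max 0 (1 - y\<^sup>2))"
  \<comment> \<open>The third power leaves a continuous function after two differentiations. The
    bound 30 is 24 + 6, read off from \<open>b''\<close>; it covers \<open>b\<close> and
    \<open>b'\<close> as well.\<close>
  define b where "b = (\<lambda>y. m y ^ 3)"
  define b' where "b' = (\<lambda>y. - (6 * (y * m y ^ 2)))"
  define b'' where "b'' = (\<lambda>y. 24 * (y\<^sup>2 * m y) - 6 * m y ^ 2)"
  have inner: "((\<lambda>y. 1 - y\<^sup>2) has_real_derivative - (2 * y)) (at y)" for y :: real
    by (auto intro!: derivative_eq_intros)
  have m_pow: "((\<lambda>y. m y ^ Suc k) has_real_derivative (Suc k * m y ^ k) * - (2 * y)) (at y)"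
    if "k \<noteq> 0" for k y
    unfolding m_def by (rule DERIV_chain2[OF has_real_derivative_max_0_power[OF that] inner])
  have m_sq: "((\<lambda>y. m y ^ 2) has_real_derivative - (4 * y * m y)) (at y)" for y
    using m_pow[of 1 y] by (simp add: numeral_2_eq_2 mult.commute mult.left_commute)
  have m: "0 \<le> m y" "m y \<le> 1" "\<bar>y\<bar> \<ge> 1 \<Longrightarrow> m y = 0" for y
    using abs_square_less_1[of y] by (auto simp: m_def max_def)
  have bd: "\<bar>y\<bar> * m y \<le> 1" for y
    using m[of y] mult_mono[of "\<bar>y\<bar>" 1 "m y" 1] by (cases "\<bar>y\<bar> \<ge> 1") auto
  have bd2: "\<bar>y\<bar> * m y ^ 2 \<le> 1" for y
    using mult_mono[OF bd[of y] m(2)[of y]] m[of y] by (simp add: power2_eq_square mult.assoc)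
  have bd3: "y\<^sup>2 * m y \<le> 1" for y
    using m[of y] mult_mono[of "y\<^sup>2" 1 "m y" 1] abs_square_le_1[of y] by (cases "\<bar>y\<bar> \<ge> 1") auto
  show ?thesis
  proof (rule that[of b b' b''])
    fix y
    show "(b has_real_derivative b' y) (at y)"
      using m_pow[of 2 y] unfolding b_def b'_def by (simp add: numeral_3_eq_3 mult.commute mult.left_commute)
    show "(b' has_real_derivative b'' y) (at y)"
      using DERIV_minus[OF DERIV_cmult[OF DERIV_mult'[OF DERIV_ident m_sq[of y]], of 6]]
      unfolding b'_def b''_def by (simp add: power2_eq_square algebra_simps)
    show "continuous_on UNIV b''"
      unfolding b''_def m_def by (intro continuous_intros)
    show "b 0 = 1"
      by (simp add: b_def m_def)
    show "b y = 0 \<and> b' y = 0 \<and> b'' y = 0" if "\<bar>y\<bar> \<ge> 1"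
      using m(3)[OF that] by (simp add: b_def b'_def b''_def)
    have "m y ^ 3 \<le> 1" "m y ^ 2 \<le> 1"
      using m[of y] by (auto intro: power_le_one)
    moreover have "0 \<le> m y ^ 3" "0 \<le> m y ^ 2" "0 \<le> y\<^sup>2 * m y"
      using m[of y] by auto
    moreover have "\<bar>y * m y ^ 2\<bar> \<le> 1"
      using bd2[of y] by (simp add: abs_mult)
    ultimately show "\<bar>b y\<bar> \<le> 30 \<and> \<bar>b' y\<bar> \<le> 30 \<and> \<bar>b'' y\<bar> \<le> 30"
      using bd3[of y] unfolding b_def b'_def b''_def by (simp only: abs_le_iff) linarith
  qed
qed

lemma C2_0_I:
  assumes "\<And>x. (f has_real_derivative f' x) (at x)" "\<And>x. (f' has_real_derivative f'' x) (at x)"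
    and "continuous_on UNIV f''" and "\<And>x. \<bar>x\<bar> \<ge> N \<Longrightarrow> f x = 0"
  shows "f \<in> C2_0" "deriv f = f'" "deriv f' = f''"
proof -
  show d: "deriv f = f'" "deriv f' = f''"
    using assms(1,2) by (auto intro!: ext DERIV_imp_deriv)
  have "closure {x. f x \<noteq> 0} \<subseteq> {-N..N}"
  proof (rule closure_minimal)
    show "{x. f x \<noteq> 0} \<subseteq> {-N..N}"
      using assms(4) by (force simp: abs_le_iff)
  qed simp
  then have "bounded (closure {x. f x \<noteq> 0})"
    using bounded_closed_interval bounded_subset by blast
  then show "f \<in> C2_0"
    using assms(1-3) unfolding C2_0_def d
    by (auto simp: field_differentiable_def compact_eq_bounded_closed d)
qed

text \<open>The approximants are \<open>g x * b (x / N)\<close>. Each derivative falling on the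
  cut-off brings a factor \<open>1 / N\<close>, which offsets the at most linear growth of
  \<open>g\<close> on the support. Both derivatives thus stay bounded uniformly in \<open>n\<close>,
  as dominated convergence requires.\<close>

lemma C2_0_approximation:
  fixes g g' g'' :: "real \<Rightarrow> real"
  assumes dg: "\<And>x. (g has_real_derivative g' x) (at x)" "\<And>x. (g' has_real_derivative g'' x) (at x)"
    and contg: "continuous_on UNIV g''"
    and bdg: "\<And>x. \<bar>g' x\<bar> \<le> B1" "\<And>x. \<bar>g'' x\<bar> \<le> B2"
  obtains G :: "nat \<Rightarrow> real \<Rightarrow> real" and C where
    "\<And>n. G n \<in> C2_0" "\<And>n x. \<bar>deriv (G n) x\<bar> \<le> C" "\<And>n x. \<bar>deriv (deriv (G n)) x\<bar> \<le> C"
    "\<And>x. (\<lambda>n. deriv (G n) x) \<longlonglongrightarrow> g' x" "\<And>x. (\<lambda>n. deriv (deriv (G n)) x) \<longlonglongrightarrow> g'' x"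
proof -
  obtain b b' b'' :: "real \<Rightarrow> real" where
    db: "\<And>y. (b has_real_derivative b' y) (at y)" "\<And>y. (b' has_real_derivative b'' y) (at y)"
    and contb: "continuous_on UNIV b''" and b_0: "b 0 = 1"
    and b_out: "\<And>y. \<bar>y\<bar> \<ge> 1 \<Longrightarrow> b y = 0 \<and> b' y = 0 \<and> b'' y = 0"
    and b_bd: "\<And>y. \<bar>b y\<bar> \<le> 30 \<and> \<bar>b' y\<bar> \<le> 30 \<and> \<bar>b'' y\<bar> \<le> 30"
    by (rule C2_bump) (rule that)
  define N where "N = (\<lambda>n. real (Suc n))"
  have N: "1 \<le> N n" "0 < N n" for n by (auto simp: N_def)
  define G where "G = (\<lambda>n x. g x * b (x / N n))"
  define G' where "G' = (\<lambda>n x. g' x * b (x / N n) + g x * (b' (x / N n) / N n))"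
  define G'' where "G'' = (\<lambda>n x. g'' x * b (x / N n) + 2 * (g' x * (b' (x / N n) / N n))
      + g x * (b'' (x / N n) / N n / N n))"
  have lin: "((\<lambda>x. x / N n) has_real_derivative 1 / N n) (at x)" for n x
    using N[of n] by (auto intro!: derivative_eq_intros)
  have d0: "((\<lambda>x. b (x / N n)) has_real_derivative b' (x / N n) / N n) (at x)" for n x
    using DERIV_chain2[OF db(1) lin] by simp
  have d1: "((\<lambda>x. b' (x / N n) / N n) has_real_derivative b'' (x / N n) / N n / N n) (at x)" for n x
    using DERIV_cdivide[OF DERIV_chain2[OF db(2) lin[of n x]], of "N n"] by simp
  have dG: "(G n has_real_derivative G' n x) (at x)" for n x
    unfolding G_def G'_def using DERIV_mult[OF dg(1) d0] by (simp add: ac_simps)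
  have dG': "(G' n has_real_derivative G'' n x) (at x)" for n x
    unfolding G'_def G''_def
    using DERIV_add[OF DERIV_mult[OF dg(2) d0[of n x]] DERIV_mult[OF dg(1) d1[of n x]]]
    by (simp add: algebra_simps)
  have cont: "continuous_on UNIV g" "continuous_on UNIV g'" "continuous_on UNIV b" "continuous_on UNIV b'"
    using dg db by (auto intro!: DERIV_isCont continuous_at_imp_continuous_on)
  have "continuous_on UNIV (G'' n)" for n
    unfolding G''_def using N[of n]
    by (intro continuous_intros contg cont continuous_on_compose2[OF contb]
        continuous_on_compose2[OF cont(3)] continuous_on_compose2[OF cont(4)]) auto
  moreover have "G n x = 0" if "\<bar>x\<bar> \<ge> N n" for n x
    using that b_out[of "x / N n"] N[of n] by (simp add: G_def)
  ultimately have G: "G n \<in> C2_0" "deriv (G n) = G' n" "deriv (G' n) = G'' n" for n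
    using C2_0_I[OF dG dG'] by blast+
  define D where "D = \<bar>g 0\<bar> + B1"
  have B: "0 \<le> B1" "0 \<le> B2"
    using bdg(1)[of 0] bdg(2)[of 0] by auto
  have growth: "\<bar>g x\<bar> \<le> \<bar>g 0\<bar> + B1 * \<bar>x\<bar>" for x
    using field_differentiable_bound[of UNIV g g' B1 x 0] dg(1) bdg(1) by auto
  \<comment> \<open>Outside this region the cut-off factors vanish; inside it \<open>g\<close> is at
    most \<open>D * N n\<close>, so a single factor \<open>1 / N n\<close> suffices.\<close>
  have g_N: "\<bar>g x\<bar> / N n \<le> D" if "\<bar>x / N n\<bar> < 1" for n x
  proof -
    have "\<bar>x\<bar> \<le> N n"
      using that N[of n] by simp
    then have "B1 * \<bar>x\<bar> \<le> B1 * N n"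
      using B by (intro mult_left_mono)
    moreover have "\<bar>g 0\<bar> * 1 \<le> \<bar>g 0\<bar> * N n"
      using N[of n] by (intro mult_left_mono) auto
    ultimately have "\<bar>g x\<bar> \<le> D * N n"
      using growth[of x] by (simp add: D_def algebra_simps)
    then show ?thesis
      using N[of n] by (simp add: divide_le_eq)
  qed
  have D: "0 \<le> D"
    using B by (simp add: D_def)
  have g_b: "\<bar>g x * (e (x / N n) / N n)\<bar> \<le> D * 30"
    if "\<And>y. \<bar>y\<bar> \<ge> 1 \<Longrightarrow> e y = 0" "\<And>y. \<bar>e y\<bar> \<le> 30" for e :: "real \<Rightarrow> real" and n x
  proof (cases "\<bar>x / N n\<bar> < 1")
    case True
    have "\<bar>g x * (e (x / N n) / N n)\<bar> = \<bar>g x\<bar> / N n * \<bar>e (x / N n)\<bar>"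
      using N[of n] by (simp add: abs_mult)
    also have "\<dots> \<le> D * 30"
      using g_N[OF True] that D by (intro mult_mono) auto
    finally show ?thesis .
  qed (use that D in simp)
  have div_N: "\<bar>z / N n\<bar> \<le> \<bar>z\<bar>" for z n
    using N[of n] mult_left_mono[of 1 "N n" "\<bar>z\<bar>"] by (simp add: divide_le_eq)
  have mult_30: "\<bar>s * t\<bar> \<le> S * 30" if "\<bar>s\<bar> \<le> S" "\<bar>t\<bar> \<le> 30" for s t S :: real
    unfolding abs_mult using that by (intro mult_mono) auto
  have gb: "\<bar>g' x * b (x / N n)\<bar> \<le> B1 * 30" "\<bar>g'' x * b (x / N n)\<bar> \<le> B2 * 30" for n x
    using b_bd by (auto intro!: mult_30 bdg)
  have gb': "\<bar>g' x * (b' (x / N n) / N n)\<bar> \<le> B1 * 30" for n x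
    using b_bd by (intro mult_30 bdg order_trans[OF div_N]) auto
  have gb'': "\<bar>g x * (b'' (x / N n) / N n / N n)\<bar> \<le> D * 30" for n x
  proof -
    have "\<bar>g x * (b'' (x / N n) / N n) / N n\<bar> \<le> D * 30"
      using b_bd b_out by (intro order_trans[OF div_N] g_b) auto
    then show ?thesis by simp
  qed
  have gb0: "\<bar>g x * (b' (x / N n) / N n)\<bar> \<le> D * 30" for n x
    using g_b[of b' x n] b_bd b_out by simp
  define C where "C = B1 * 90 + B2 * 30 + D * 30"
  have "\<bar>G' n x\<bar> \<le> C" for n x
    using gb(1)[of x n] gb0[of x n] B D unfolding G'_def C_def by linarith
  moreover have "\<bar>G'' n x\<bar> \<le> C" for n x
    using gb(2)[of x n] gb'[of x n] gb''[of x n] B unfolding G''_def C_def by linarith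
  moreover have lim: "(\<lambda>n. x / N n) \<longlonglongrightarrow> 0" for x
    unfolding N_def by (rule LIMSEQ_Suc[OF lim_const_over_n])
  have lim_b: "(\<lambda>n. b (x / N n)) \<longlonglongrightarrow> 1" for x
    using isCont_tendsto_compose[OF DERIV_isCont[OF db(1)] lim] b_0 by metis
  have lim_b': "(\<lambda>n. b' (x / N n) / N n) \<longlonglongrightarrow> 0" for x
    using tendsto_mult[OF isCont_tendsto_compose[OF DERIV_isCont[OF db(2)] lim[of x]] lim[of 1]] by simp
  have lim_b'': "(\<lambda>n. b'' (x / N n) / N n / N n) \<longlonglongrightarrow> 0" for x
  proof -
    have "isCont b'' 0"
      using contb by (simp add: continuous_on_eq_continuous_at)
    from tendsto_mult[OF tendsto_mult[OF isCont_tendsto_compose[OF this lim[of x]] lim[of 1]] lim[of 1]]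
    show ?thesis by simp
  qed
  have "(\<lambda>n. G' n x) \<longlonglongrightarrow> g' x" for x
    unfolding G'_def
    using tendsto_add[OF tendsto_mult[OF tendsto_const lim_b] tendsto_mult[OF tendsto_const lim_b']] by simp
  moreover have "(\<lambda>n. G'' n x) \<longlonglongrightarrow> g'' x" for x
  proof -
    have "(\<lambda>n. G'' n x) \<longlonglongrightarrow> g'' x * 1 + 2 * (g' x * 0) + g x * 0"
      unfolding G''_def by (intro tendsto_intros lim_b lim_b' lim_b'')
    then show ?thesis by simp
  qed
  ultimately show ?thesis
    using G by (intro that[of G C]) simp_all
qed

text \<open>This admits the value function, which lacks compact support, as a test function. The
  integrands of the approximants are dominated under \<open>\<mu>\<close> by a constant plus a
  multiple of \<open>\<bar>u\<bar>\<close>, where integrability of \<open>u\<close> enters, and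
  under the finite measure \<open>\<rho>\<close> by a constant.\<close>

lemma admissible_extend:
  fixes g g' g'' :: "real \<Rightarrow> real"
  assumes adm: "(\<mu>, \<rho>) \<in> admissible a" and u: "integrable \<mu> snd"
    and dg: "\<And>x. (g has_real_derivative g' x) (at x)" "\<And>x. (g' has_real_derivative g'' x) (at x)"
    and contg: "continuous_on UNIV g''"
    and bdg: "\<And>x. \<bar>g' x\<bar> \<le> B1" "\<And>x. \<bar>g'' x\<bar> \<le> B2"
  shows "integrable \<mu> (\<lambda>(x, u). 1/2 * a * g'' x + u * g' x)"
    and "integrable \<rho> (\<lambda>(x, \<gamma>, \<delta>). \<gamma> * g' x)"
    and "(\<integral>(x, u). 1/2 * a * g'' x + u * g' x \<partial>\<mu>) + (\<integral>(x, \<gamma>, \<delta>). \<gamma> * g' x \<partial>\<rho>) = 0"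
proof -
  obtain G C where G: "\<And>n. G n \<in> C2_0"
    and bd: "\<And>n x. \<bar>deriv (G n) x\<bar> \<le> C" "\<And>n x. \<bar>deriv (deriv (G n)) x\<bar> \<le> C"
    and lim: "\<And>x. (\<lambda>n. deriv (G n) x) \<longlonglongrightarrow> g' x" "\<And>x. (\<lambda>n. deriv (deriv (G n)) x) \<longlonglongrightarrow> g'' x"
    using C2_0_approximation[OF dg contg bdg] by blast
  interpret \<mu>: prob_space \<mu> using adm by (simp add: admissible_def)
  interpret \<rho>: finite_measure \<rho> using adm by (simp add: admissible_def)
  have sets_\<mu>: "sets \<mu> = sets (borel \<Otimes>\<^sub>M borel)"
    unfolding borel_prod using adm by (simp add: admissible_def)
  have sets_\<rho>: "sets \<rho> = sets (restrict_space (borel \<Otimes>\<^sub>M borel \<Otimes>\<^sub>M borel) (UNIV \<times> {-1, 1} \<times> {0..}))"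
    unfolding borel_prod using adm by (simp add: admissible_def jump_space_def)
  have space_\<rho>: "space \<rho> = UNIV \<times> {-1, 1} \<times> {0..}"
    using sets_eq_imp_space_eq[OF sets_\<rho>] by (simp add: space_restrict_space space_pair_measure)
  have meas[measurable]: "g' \<in> borel_measurable borel" "g'' \<in> borel_measurable borel"
    using dg(2) contg
    by (auto intro!: borel_measurable_continuous_onI DERIV_isCont continuous_at_imp_continuous_on)
  have int_n: "integrable \<mu> (\<lambda>(x, u). 1/2 * a * deriv (deriv (G n)) x + u * deriv (G n) x)"
    "integrable \<rho> (\<lambda>(x, \<gamma>, \<delta>). \<gamma> * deriv (G n) x)"
    "(\<integral>(x, u). 1/2 * a * deriv (deriv (G n)) x + u * deriv (G n) x \<partial>\<mu>)
      + (\<integral>(x, \<gamma>, \<delta>). \<gamma> * deriv (G n) x \<partial>\<rho>) = 0" for n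
    using adm G[of n] by (auto simp: admissible_def)
  have C: "0 \<le> C" using bd(1)[of 0 0] by simp
  have m1: "(\<lambda>(x, u). 1/2 * a * g'' x + u * g' x) \<in> borel_measurable \<mu>"
    unfolding measurable_cong_sets[OF sets_\<mu> refl] by measurable
  have m2: "(\<lambda>(x, \<gamma>, \<delta>). \<gamma> * g' x) \<in> borel_measurable \<rho>"
    unfolding measurable_cong_sets[OF sets_\<rho> refl] by (intro measurable_restrict_space1) measurable
  have b1: "integrable \<mu> (\<lambda>p. 1/2 * \<bar>a\<bar> * C + \<bar>snd p\<bar> * C)"
    using integrable_mult_left[OF integrable_abs[OF u], of C] by simp
  have b2: "integrable \<rho> (\<lambda>_. C)" by simp
  have bound1: "\<bar>1/2 * a * deriv (deriv (G n)) x + v * deriv (G n) x\<bar> \<le> 1/2 * \<bar>a\<bar> * C + \<bar>v\<bar> * C" for n x v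
  proof -
    have "\<bar>1/2 * a * deriv (deriv (G n)) x\<bar> \<le> 1/2 * \<bar>a\<bar> * C"
      unfolding abs_mult using bd(2)[of n x] by (auto intro: mult_left_mono)
    moreover have "\<bar>v * deriv (G n) x\<bar> \<le> \<bar>v\<bar> * C"
      unfolding abs_mult using bd(1)[of n x] by (auto intro: mult_left_mono)
    ultimately show ?thesis by linarith
  qed
  have conv1: "(\<lambda>n. 1/2 * a * deriv (deriv (G n)) x + v * deriv (G n) x) \<longlonglongrightarrow> 1/2 * a * g'' x + v * g' x" for x v
    by (intro tendsto_intros lim)
  have conv2: "(\<lambda>n. \<gamma> * deriv (G n) x) \<longlonglongrightarrow> \<gamma> * g' x" for x \<gamma>
    by (intro tendsto_intros lim)
  \<comment> \<open>On the jump space \<open>\<bar>\<gamma>\<bar> = 1\<close>, so the bound on the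
    derivative already bounds the integrand.\<close>
  have bound2: "AE p in \<rho>. norm ((\<lambda>(x, \<gamma>, \<delta>). \<gamma> * deriv (G n) x) p) \<le> C" for n
    using bd(1) by (intro AE_I2) (auto simp: space_\<rho> abs_mult)
  note dom1 = m1 borel_measurable_integrable[OF int_n(1)] b1
  have A1: "AE p in \<mu>. (\<lambda>n. (\<lambda>(x, u). 1/2 * a * deriv (deriv (G n)) x + u * deriv (G n) x) p)
      \<longlonglongrightarrow> (\<lambda>(x, u). 1/2 * a * g'' x + u * g' x) p"
    using conv1 by (intro AE_I2) (simp add: split_beta)
  have A2: "AE p in \<mu>. norm ((\<lambda>(x, u). 1/2 * a * deriv (deriv (G n)) x + u * deriv (G n) x) p)
      \<le> 1/2 * \<bar>a\<bar> * C + \<bar>snd p\<bar> * C" for n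
    using bound1 by (intro AE_I2) (simp add: split_beta)
  have A3: "AE p in \<rho>. (\<lambda>n. (\<lambda>(x, \<gamma>, \<delta>). \<gamma> * deriv (G n) x) p) \<longlonglongrightarrow> (\<lambda>(x, \<gamma>, \<delta>). \<gamma> * g' x) p"
    using conv2 by (intro AE_I2) (simp add: split_beta)
  show "integrable \<mu> (\<lambda>(x, u). 1/2 * a * g'' x + u * g' x)"
    by (rule integrable_dominated_convergence[OF dom1 A1 A2])
  show "integrable \<rho> (\<lambda>(x, \<gamma>, \<delta>). \<gamma> * g' x)"
    by (rule integrable_dominated_convergence[OF m2 borel_measurable_integrable[OF int_n(2)] b2 A3 bound2])
  have "(\<lambda>n. (\<integral>(x, u). 1/2 * a * deriv (deriv (G n)) x + u * deriv (G n) x \<partial>\<mu>)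
      + (\<integral>(x, \<gamma>, \<delta>). \<gamma> * deriv (G n) x \<partial>\<rho>))
    \<longlonglongrightarrow> (\<integral>(x, u). 1/2 * a * g'' x + u * g' x \<partial>\<mu>) + (\<integral>(x, \<gamma>, \<delta>). \<gamma> * g' x \<partial>\<rho>)"
    by (rule tendsto_add[OF integral_dominated_convergence[OF dom1 A1 A2]
      integral_dominated_convergence[OF m2 borel_measurable_integrable[OF int_n(2)] b2 A3 bound2]])
  then show "(\<integral>(x, u). 1/2 * a * g'' x + u * g' x \<partial>\<mu>) + (\<integral>(x, \<gamma>, \<delta>). \<gamma> * g' x \<partial>\<rho>) = 0"
    unfolding int_n(3) by (rule LIMSEQ_unique[OF _ tendsto_const])
qed

section \<open>The verification inequality\<close>

lemma cost_lower_bound: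
  fixes w w' w'' :: "real \<Rightarrow> real"
  assumes adm: "(\<mu>, \<rho>) \<in> admissible a"
    and dw: "\<And>x. (w has_real_derivative w' x) (at x)" "\<And>x. (w' has_real_derivative w'' x) (at x)"
    and contw: "continuous_on UNIV w''"
    and bd: "\<And>x. \<bar>w' x\<bar> \<le> h" "\<And>x. \<bar>w'' x\<bar> \<le> B"
    and "l > 0" "r \<ge> 0"
    and hjb: "\<And>x. I \<le> 1/2 * a * w'' x - (w' x)\<^sup>2 / (4 * l) + r * x\<^sup>2"
  shows "ennreal I \<le> cost r l h \<mu> \<rho>"
proof (cases "(\<integral>\<^sup>+(x, u). ennreal (r * x\<^sup>2 + l * u\<^sup>2) \<partial>\<mu>) = \<infinity>")
  case True
  then show ?thesis by (simp add: cost_def)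
next
  case False
  interpret \<mu>: prob_space \<mu> using adm by (simp add: admissible_def)
  interpret \<rho>: finite_measure \<rho> using adm by (simp add: admissible_def)
  have sets_\<mu>: "sets \<mu> = sets (borel \<Otimes>\<^sub>M borel)"
    unfolding borel_prod using adm by (simp add: admissible_def)
  have sets_\<rho>: "sets \<rho> = sets (restrict_space (borel \<Otimes>\<^sub>M borel \<Otimes>\<^sub>M borel) (UNIV \<times> {-1, 1} \<times> {0..}))"
    unfolding borel_prod using adm by (simp add: admissible_def jump_space_def)
  have space_\<rho>: "space \<rho> = UNIV \<times> {-1, 1} \<times> {0..}"
    using sets_eq_imp_space_eq[OF sets_\<rho>] by (simp add: space_restrict_space space_pair_measure)
  have h: "0 \<le> h" using bd(1)[of 0] by simp
  have nonneg: "0 \<le> r * x\<^sup>2 + l * v\<^sup>2" for x v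
    using \<open>l > 0\<close> \<open>r \<ge> 0\<close> by simp
  have meas: "(\<lambda>(x, u). r * x\<^sup>2 + l * u\<^sup>2) \<in> borel_measurable \<mu>" "snd \<in> borel_measurable \<mu>"
    unfolding measurable_cong_sets[OF sets_\<mu> refl] by measurable
  have int_\<mu>: "integrable \<mu> (\<lambda>(x, u). r * x\<^sup>2 + l * u\<^sup>2)"
  proof (rule integrableI_nonneg[OF meas(1)])
    show "AE p in \<mu>. 0 \<le> (\<lambda>(x, u). r * x\<^sup>2 + l * u\<^sup>2) p"
      using nonneg by (intro AE_I2) (simp add: split_beta)
    show "(\<integral>\<^sup>+p. ennreal ((\<lambda>(x, u). r * x\<^sup>2 + l * u\<^sup>2) p) \<partial>\<mu>) < \<infinity>"
      using False by (simp add: case_prod_unfold less_top)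
  qed
  \<comment> \<open>Finite cost bounds the second moment of \<open>u\<close>, and
    \<open>\<bar>u\<bar> \<le> 1 + u\<^sup>2\<close> then bounds the first. This permits testing the
    constraint with \<open>w\<close>.\<close>
  have int_u: "integrable \<mu> snd"
  proof (rule Bochner_Integration.integrable_bound)
    show "integrable \<mu> (\<lambda>p. 1 + (case p of (x, u) \<Rightarrow> r * x\<^sup>2 + l * u\<^sup>2) / l)"
      using int_\<mu> by simp
    show "snd \<in> borel_measurable \<mu>" by fact
    have "\<bar>v\<bar> \<le> 1 + (r * x\<^sup>2 + l * v\<^sup>2) / l" for x v
    proof -
      have "0 \<le> (\<bar>v\<bar> - 1)\<^sup>2" by simp
      then have "\<bar>v\<bar> \<le> 1 + v\<^sup>2" by (simp add: power2_diff)
      moreover have "v\<^sup>2 \<le> (r * x\<^sup>2 + l * v\<^sup>2) / l"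
        using \<open>l > 0\<close> \<open>r \<ge> 0\<close> by (simp add: field_simps)
      ultimately show ?thesis by linarith
    qed
    from order_trans[OF this abs_ge_self]
    have "\<bar>snd p\<bar> \<le> \<bar>1 + (case p of (x, u) \<Rightarrow> r * x\<^sup>2 + l * u\<^sup>2) / l\<bar>" for p
      unfolding case_prod_unfold .
    then show "AE p in \<mu>. norm (snd p) \<le> norm (1 + (case p of (x, u) \<Rightarrow> r * x\<^sup>2 + l * u\<^sup>2) / l)"
      by simp
  qed
  note ext = admissible_extend[OF adm int_u dw contw bd]
  have int_\<rho>: "integrable \<rho> (\<lambda>(x, \<gamma>, \<delta>). h * \<bar>\<gamma>\<bar>)"
  proof -
    have "integrable \<rho> (\<lambda>p. h)" by simp
    then show ?thesis
      by (rule Bochner_Integration.integrable_cong[OF refl, THEN iffD1, rotated])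
        (auto simp: space_\<rho>)
  qed
  have "I - (\<integral>(x, u). 1/2 * a * w'' x + u * w' x \<partial>\<mu>)
      = (\<integral>p. I - (\<lambda>(x, u). 1/2 * a * w'' x + u * w' x) p \<partial>\<mu>)"
    using ext(1) by (subst Bochner_Integration.integral_diff) (auto simp: \<mu>.prob_space)
  also have "\<dots> \<le> (\<integral>(x, u). r * x\<^sup>2 + l * u\<^sup>2 \<partial>\<mu>)"
  proof (rule integral_mono)
    show "integrable \<mu> (\<lambda>p. I - (\<lambda>(x, u). 1/2 * a * w'' x + u * w' x) p)"
      using ext(1) by simp
    have "I - (1/2 * a * w'' x + v * w' x) \<le> r * x\<^sup>2 + l * v\<^sup>2" for x v
    proof -
      \<comment> \<open>Completing the square in \<open>v\<close>; equality holds at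
        \<open>v = - w' x / (2 * l)\<close>, the control later shown to be optimal.\<close>
      have "0 \<le> (2 * l * v + w' x)\<^sup>2 / (4 * l)"
        using \<open>l > 0\<close> by simp
      also have "\<dots> = l * v\<^sup>2 + v * w' x + (w' x)\<^sup>2 / (4 * l)"
        using \<open>l > 0\<close> by (simp add: field_simps power2_eq_square)
      finally show ?thesis using hjb[of x] by linarith
    qed
    then show "I - (\<lambda>(x, u). 1/2 * a * w'' x + u * w' x) p \<le> (\<lambda>(x, u). r * x\<^sup>2 + l * u\<^sup>2) p" for p
      by (simp add: split_beta)
  qed fact
  finally have 1: "I \<le> (\<integral>(x, u). r * x\<^sup>2 + l * u\<^sup>2 \<partial>\<mu>) + (\<integral>(x, u). 1/2 * a * w'' x + u * w' x \<partial>\<mu>)"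
    by simp
  have "- (\<integral>(x, \<gamma>, \<delta>). \<gamma> * w' x \<partial>\<rho>) = (\<integral>p. - (\<lambda>(x, \<gamma>, \<delta>). \<gamma> * w' x) p \<partial>\<rho>)"
    by simp
  also have "\<dots> \<le> (\<integral>(x, \<gamma>, \<delta>). h * \<bar>\<gamma>\<bar> \<partial>\<rho>)"
  proof (rule integral_mono)
    show "integrable \<rho> (\<lambda>p. - (\<lambda>(x, \<gamma>, \<delta>). \<gamma> * w' x) p)"
      using ext(2) by simp
    have "- (\<gamma> * w' x) \<le> h * \<bar>\<gamma>\<bar>" if "\<gamma> \<in> {-1, 1}" for x \<gamma> :: real
      using bd(1)[of x] that by auto
    then show "- (\<lambda>(x, \<gamma>, \<delta>). \<gamma> * w' x) p \<le> (\<lambda>(x, \<gamma>, \<delta>). h * \<bar>\<gamma>\<bar>) p" if "p \<in> space \<rho>" for p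
      using that by (auto simp: space_\<rho>)
  qed fact
  finally have "I \<le> (\<integral>(x, u). r * x\<^sup>2 + l * u\<^sup>2 \<partial>\<mu>) + (\<integral>(x, \<gamma>, \<delta>). h * \<bar>\<gamma>\<bar> \<partial>\<rho>)"
    using 1 ext(3) by linarith
  moreover have "(\<integral>\<^sup>+p. ennreal ((\<lambda>(x, u). r * x\<^sup>2 + l * u\<^sup>2) p) \<partial>\<mu>)
      = ennreal (\<integral>(x, u). r * x\<^sup>2 + l * u\<^sup>2 \<partial>\<mu>)"
    using nonneg by (intro nn_integral_eq_integral int_\<mu> AE_I2) (simp add: split_beta)
  moreover have "(\<integral>\<^sup>+p. ennreal ((\<lambda>(x, \<gamma>, \<delta>). h * \<bar>\<gamma>\<bar>) p) \<partial>\<rho>)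
      = ennreal (\<integral>(x, \<gamma>, \<delta>). h * \<bar>\<gamma>\<bar> \<partial>\<rho>)"
    using h by (intro nn_integral_eq_integral int_\<rho> AE_I2) (simp add: split_beta)
  moreover have "0 \<le> (\<integral>(x, u). r * x\<^sup>2 + l * u\<^sup>2 \<partial>\<mu>)" "0 \<le> (\<integral>(x, \<gamma>, \<delta>). h * \<bar>\<gamma>\<bar> \<partial>\<rho>)"
    using nonneg h by (auto intro!: integral_nonneg simp: split_beta)
  ultimately show ?thesis
    unfolding cost_def by (simp add: case_prod_unfold ennreal_leI flip: ennreal_plus)
qed

section \<open>The optimal measures\<close>

text \<open>The flux \<open>1/2 * a * p' x - u x * p x\<close> has zero derivative in the interior
  by the differential equation, is continuous up to the endpoints and vanishes at
  \<open>-U\<close>.\<close>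

lemma stationary_density_zero_flux:
  assumes "stationary_density a U u p" "U > 0"
    and contu: "continuous_on {-U..U} u" and du: "\<And>x. x \<in> {-U<..<U} \<Longrightarrow> u differentiable (at x)"
  obtains p' where "\<And>x. x \<in> {-U..U} \<Longrightarrow> (p has_real_derivative p' x) (at x within {-U..U})"
    "continuous_on {-U..U} p'" "\<And>x. x \<in> {-U..U} \<Longrightarrow> 1/2 * a * p' x = u x * p x"
proof -
  obtain p' p'' where
    dp: "\<And>x. x \<in> {-U..U} \<Longrightarrow> (p has_real_derivative p' x) (at x within {-U..U})"
      "\<And>x. x \<in> {-U..U} \<Longrightarrow> (p' has_real_derivative p'' x) (at x within {-U..U})"
    and ode: "\<And>x. x \<in> {-U<..<U} \<Longrightarrow> 1/2 * a * p'' x - deriv (\<lambda>y. u y * p y) x = 0"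
    and bc: "\<And>x. x \<in> {-U, U} \<Longrightarrow> 1/2 * a * p' x - u x * p x = 0"
    using assms(1) unfolding stationary_density_def by blast
  have cont: "continuous_on {-U..U} p" "continuous_on {-U..U} p'"
    using DERIV_continuous_on[OF dp(1)] DERIV_continuous_on[OF dp(2)] by auto
  have "1/2 * a * p' x = u x * p x" if "x \<in> {-U..U}" for x
  proof -
    have "1/2 * a * p' x - u x * p x = 1/2 * a * p' (-U) - u (-U) * p (-U)"
    proof (rule DERIV_isconst2[of "-U" U])
      show "continuous_on {-U..U} (\<lambda>x. 1/2 * a * p' x - u x * p x)"
        by (intro continuous_intros cont contu)
      fix y assume y: "- U < y" "y < U"
      then have at: "at y within {-U..U} = at y"
        by (intro at_within_interior) simp
      have dy: "(p has_real_derivative p' y) (at y)" "(p' has_real_derivative p'' y) (at y)"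
        using dp[of y] y by (auto simp: at)
      \<comment> \<open>\<open>deriv\<close> is an arbitrary choice where no derivative exists, so
        the product must be shown differentiable before the equation says anything about the
        flux.\<close>
      obtain u' where "(u has_real_derivative u') (at y)"
        using du[of y] y by (auto simp: real_differentiable_def)
      from DERIV_mult[OF this dy(1)]
      have up: "((\<lambda>y. u y * p y) has_real_derivative deriv (\<lambda>y. u y * p y) y) (at y)"
        by (metis DERIV_imp_deriv)
      show "((\<lambda>x. 1/2 * a * p' x - u x * p x) has_real_derivative 0) (at y)"
        using DERIV_diff[OF DERIV_cmult[OF dy(2), of "1/2 * a"] up] ode[of y] y by simp
    qed (use that \<open>U > 0\<close> in auto)
    with bc[of "-U"] show ?thesis by simp
  qed
  with dp cont show ?thesis
    by (intro that[of p']) auto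
qed

text \<open>Zero flux makes \<open>p\<close> proportional to \<open>exp (2 V / a)\<close> for a primitive \<open>V\<close> of the drift, and the
  normalisation forces the factor to be positive.\<close>

lemma stationary_density_nonneg:
  assumes st: "stationary_density a U u p" and "U > 0" "a \<noteq> 0"
    and dV: "\<And>x. (V has_real_derivative u x) (at x)" and du: "\<And>x. (u has_real_derivative u' x) (at x)"
    and "x \<in> {-U..U}"
  shows "0 \<le> p x"
proof -
  have "continuous_on {-U..U} u"
    using du by (auto intro!: DERIV_isCont continuous_at_imp_continuous_on)
  moreover have "u differentiable (at x)" for x
    using du by (auto simp: real_differentiable_def)
  ultimately obtain p' where
    dp: "\<And>x. x \<in> {-U..U} \<Longrightarrow> (p has_real_derivative p' x) (at x within {-U..U})"
    and flux: "\<And>x. x \<in> {-U..U} \<Longrightarrow> 1/2 * a * p' x = u x * p x"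
    using stationary_density_zero_flux[OF st \<open>U > 0\<close>] by metis
  have dV': "((\<lambda>x. exp (- (2 / a * V x))) has_real_derivative
      exp (- (2 / a * V x)) * - (2 / a * u x)) (at x within {-U..U})" for x
    by (intro DERIV_chain2[OF DERIV_exp] DERIV_minus DERIV_cmult has_field_derivative_at_within[OF dV])
  have "\<exists>c. \<forall>x\<in>{-U..U}. p x * exp (- (2 / a * V x)) = c"
  proof (rule has_field_derivative_zero_constant)
    fix x assume x: "x \<in> {-U..U}"
    have "p' x = 2 / a * u x * p x"
      using flux[OF x] \<open>a \<noteq> 0\<close> by (simp add: field_simps)
    then have "p' x * exp (- (2 / a * V x)) + exp (- (2 / a * V x)) * - (2 / a * u x) * p x = 0"
      by (simp add: algebra_simps)
    then show "((\<lambda>x. p x * exp (- (2 / a * V x))) has_real_derivative 0) (at x within {-U..U})"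
      using DERIV_mult[OF dp[OF x] dV'] by simp
  qed simp
  then obtain c where "\<And>x. x \<in> {-U..U} \<Longrightarrow> p x * exp (- (2 / a * V x)) = c"
    by blast
  then have p: "p x = c * exp (2 / a * V x)" if "x \<in> {-U..U}" for x
    using that by (simp add: exp_minus field_simps)
  have int: "(p has_integral 1) {-U..U}"
    using st by (auto simp: stationary_density_def)
  have "0 \<le> c"
  proof (rule ccontr)
    assume "\<not> 0 \<le> c"
    then have "0 \<le> - p x" if "x \<in> {-U..U}" for x
      using p[OF that] by (simp add: mult_nonpos_nonneg)
    from has_integral_nonneg[OF has_integral_neg[OF int] this] show False by simp
  qed
  with p[OF \<open>x \<in> {-U..U}\<close>] show ?thesis by simp
qed

text \<open>Zero flux is a first-order linear equation, solved by \<open>exp (2 / a * V x)\<close>;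
  dividing by the integral over \<open>[-U, U]\<close> normalises the solution.\<close>

lemma stationary_density_exists:
  assumes "U > 0" "a \<noteq> 0"
    and dV: "\<And>x. (V has_real_derivative u x) (at x)" and du: "\<And>x. (u has_real_derivative u' x) (at x)"
    and contu': "continuous_on UNIV u'"
  shows "\<exists>p. stationary_density a U u p"
proof -
  define e where "e = (\<lambda>x. exp (2 / a * V x))"
  have de: "(e has_real_derivative 2 / a * (u x * e x)) (at x)" for x
    unfolding e_def using DERIV_fun_exp[OF DERIV_cmult[OF dV[of x], of "2 / a"]]
    by (simp add: ac_simps)
  have cont: "continuous_on S e" "continuous_on S u" "continuous_on S u'" for S
    using de du continuous_on_subset[OF contu'] by (auto intro!: DERIV_isCont continuous_at_imp_continuous_on)
  define Z where "Z = integral {-U..U} e"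
  have Z_int: "(e has_integral Z) {-U..U}"
    unfolding Z_def using integrable_continuous_interval[OF cont(1)] by (rule integrable_integral)
  \<comment> \<open>The minimum of \<open>e\<close> on the compact interval is positive, which gives
    \<open>Z > 0\<close>.\<close>
  have "\<exists>z\<in>{-U..U}. \<forall>y\<in>{-U..U}. e z \<le> e y"
    using \<open>U > 0\<close> cont by (intro continuous_attains_inf) auto
  then obtain z where z: "\<And>y. y \<in> {-U..U} \<Longrightarrow> e z \<le> e y" by blast
  have "e z * (2 * U) \<le> Z"
    using has_integral_le[OF has_integral_const_real[of "e z" "-U" U] Z_int] z \<open>U > 0\<close>
    by (simp add: mult.commute)
  moreover have "0 < e z * (2 * U)"
    using \<open>U > 0\<close> by (simp add: e_def)
  ultimately have Z: "Z > 0" by linarith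
  define p where "p = (\<lambda>x. e x / Z)"
  define p' where "p' = (\<lambda>x. 2 / a * (u x * p x))"
  define p'' where "p'' = (\<lambda>x. 2 / a * (u' x * p x + u x * p' x))"
  have dp: "(p has_real_derivative p' x) (at x)" for x
    unfolding p_def p'_def using DERIV_cdivide[OF de] by simp
  have dup: "((\<lambda>x. u x * p x) has_real_derivative u' x * p x + u x * p' x) (at x)" for x
    using DERIV_mult[OF du dp] by (simp add: ac_simps)
  have dp': "(p' has_real_derivative p'' x) (at x)" for x
    using DERIV_cmult[OF dup, of "2 / a"] unfolding p''_def by (simp add: p'_def)
  have "stationary_density a U u p"
    unfolding stationary_density_def
  proof (rule exI[of _ p'], rule exI[of _ p''], intro conjI ballI)
    show "continuous_on {-U..U} p''"
      unfolding p''_def p'_def p_def by (intro continuous_intros cont) (use Z in auto)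
    show "(p has_integral 1) {-U..U}"
      using has_integral_mult_left[OF Z_int, of "1 / Z"] Z by (simp add: p_def)
    show "1/2 * a * p'' x - deriv (\<lambda>y. u y * p y) x = 0" for x
      using DERIV_imp_deriv[OF dup] \<open>a \<noteq> 0\<close> by (simp add: p''_def)
    show "1/2 * a * p' x - u x * p x = 0" for x
      using \<open>a \<noteq> 0\<close> by (simp add: p'_def)
  qed (use dp dp' in \<open>auto intro: has_field_derivative_at_within\<close>)
  then show ?thesis by blast
qed

section \<open>Integration against the two optimal measures\<close>

text \<open>Passing through the image measure and the density reduces the integral to the
  fundamental theorem of calculus; integrability and value come together. Nonnegativity of
  \<open>p\<close> ensures that \<open>ennreal\<close> does not truncate the density.\<close>

lemma has_bochner_integral_mu_star:
  assumes "U > 0" "continuous_on {-U..U} p" "\<And>x. x \<in> {-U..U} \<Longrightarrow> 0 \<le> p x"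
    and u: "u \<in> borel_measurable borel" and g: "g \<in> borel_measurable borel"
    and dF: "\<And>x. x \<in> {-U..U} \<Longrightarrow> (F has_real_derivative p x * g (x, u x)) (at x within {-U..U})"
    and cont: "continuous_on {-U..U} (\<lambda>x. g (x, u x))"
  shows "has_bochner_integral (mu_star U u p) g (F U - F (- U))"
proof -
  have xu: "(\<lambda>x. (x, u x)) \<in> measurable borel borel"
    using u by (simp add: borel_prod[symmetric])
  have "(\<lambda>x. indicator {-U..U} x *\<^sub>R p x) \<in> borel_measurable borel"
    using assms(2) by (intro borel_measurable_continuous_on_indicator) auto
  then have p: "(\<lambda>x. indicator {-U..U} x * p x) \<in> borel_measurable lborel"
    by simp
  have "has_bochner_integral lborel (\<lambda>x. indicator {-U..U} x *\<^sub>R (p x * g (x, u x))) (F U - F (- U))"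
    using \<open>U > 0\<close> dF assms(2) cont
    by (intro has_bochner_integral_FTC_Icc continuous_intros)
      (auto simp: has_real_derivative_iff_has_vector_derivative)
  then have "has_bochner_integral lborel (\<lambda>x. (indicator {-U..U} x * p x) *\<^sub>R g (x, u x)) (F U - F (- U))"
    by (simp add: mult.assoc)
  then have "has_bochner_integral (density lborel (\<lambda>x. ennreal (indicator {-U..U} x * p x)))
      (\<lambda>x. g (x, u x)) (F U - F (- U))"
    using xu g p assms(3) by (intro has_bochner_integral_density)
      (auto intro!: AE_I2 measurable_compose[OF _ g] split: split_indicator)
  then show ?thesis
    unfolding mu_star_def using xu g by (intro has_bochner_integral_distr) auto
qed

lemma prob_space_mu_star:
  assumes "U > 0" "continuous_on {-U..U} p" "\<And>x. x \<in> {-U..U} \<Longrightarrow> 0 \<le> p x"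
    and "u \<in> borel_measurable borel" and int: "(p has_integral 1) {-U..U}"
  shows "prob_space (mu_star U u p)"
proof
  have "has_bochner_integral (mu_star U u p) (\<lambda>_. 1 :: real)
      (integral {-U..U} p - integral {-U..-U} p)"
    using integral_has_real_derivative[OF assms(2)] assms
    by (intro has_bochner_integral_mu_star) auto
  then have "has_bochner_integral (mu_star U u p) (\<lambda>_. 1 :: real) 1"
    using integral_unique[OF int] by simp
  then have "(\<integral>\<^sup>+x. ennreal 1 \<partial>mu_star U u p) = ennreal 1"
    by (subst nn_integral_eq_integral) (auto simp: has_bochner_integral_iff)
  then show "emeasure (mu_star U u p) (space (mu_star U u p)) = 1"
    by simp
qed

text \<open>\<open>measure_of\<close> yields the null measure unless the given set function is
  countably additive. Writing \<open>rho_star\<close> as the image of a two-point measure on the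
  booleans supplies the additivity.\<close>

lemma rho_star_eq_distr:
  "rho_star a U p = distr (point_measure UNIV (\<lambda>b. ennreal (1/2 * a * p (if b then U else - U))))
    jump_space (\<lambda>b. if b then (U, -1, 0) else (-U, 1, 0))" (is "_ = distr ?M _ ?f")
proof -
  have "space jump_space = UNIV \<times> {-1, 1} \<times> {0..}"
    by (simp add: jump_space_def space_restrict_space)
  then have f: "?f \<in> measurable ?M jump_space"
    by auto
  have eq: "emeasure (distr ?M jump_space ?f) A = ennreal (1/2 * a * p (-U)) * indicator A (-U, 1, 0)
        + ennreal (1/2 * a * p U) * indicator A (U, -1, 0)" if "A \<in> sets jump_space" for A
  proof -
    have "?f -` A \<inter> space ?M = {b. ?f b \<in> A}"
      by (auto simp: space_point_measure)
    then have "emeasure (distr ?M jump_space ?f) A = emeasure ?M {b. ?f b \<in> A}"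
      using emeasure_distr[OF f that] by simp
    also have "\<dots> = (\<Sum>b\<in>{b. ?f b \<in> A}. ennreal (1/2 * a * p (if b then U else - U)))"
      by (intro emeasure_point_measure_finite) auto
    also have "\<dots> = (\<Sum>b\<in>UNIV. if ?f b \<in> A then ennreal (1/2 * a * p (if b then U else - U)) else 0)"
      by (simp add: sum.If_cases)
    finally show ?thesis
      by (simp add: UNIV_bool indicator_def)
  qed
  have "rho_star a U p = measure_of (space jump_space) (sets jump_space) (emeasure (distr ?M jump_space ?f))"
    unfolding rho_star_def using sets.space_closed
    by (intro measure_of_eq) (simp_all only: eq sets.sigma_sets_eq)
  also have "\<dots> = distr ?M jump_space ?f"
    using measure_of_of_measure[of "distr ?M jump_space ?f"] by simp
  finally show ?thesis .
qed

text \<open>The two-point picture turns the integral into a finite sum. The sign conditions keep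
  \<open>ennreal\<close> from truncating the weights.\<close>

lemma has_bochner_integral_rho_star:
  fixes g :: "real \<times> real \<times> real \<Rightarrow> real"
  assumes "0 \<le> a * p (-U)" "0 \<le> a * p U" and g: "g \<in> borel_measurable jump_space"
  shows "has_bochner_integral (rho_star a U p) g
    (1/2 * a * p (-U) * g (-U, 1, 0) + 1/2 * a * p U * g (U, -1, 0))"
proof -
  let ?M = "point_measure UNIV (\<lambda>b. ennreal (1/2 * a * p (if b then U else - U)))"
  let ?f = "\<lambda>b. if b then (U, -1, 0) else (-U, 1, 0 :: real)"
  have "space jump_space = UNIV \<times> {-1, 1} \<times> {0..}"
    by (simp add: jump_space_def space_restrict_space)
  then have f: "?f \<in> measurable ?M jump_space"
    by auto
  have "has_bochner_integral ?M (\<lambda>b. g (?f b)) (\<Sum>b\<in>UNIV. 1/2 * a * p (if b then U else - U) * g (?f b))"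
    unfolding has_bochner_integral_iff using assms
    by (subst lebesgue_integral_point_measure_finite) (auto intro: integrable_point_measure_finite)
  also have "(\<Sum>b\<in>UNIV. 1/2 * a * p (if b then U else - U) * g (?f b))
      = 1/2 * a * p (-U) * g (-U, 1, 0) + 1/2 * a * p U * g (U, -1, 0)"
    by (simp add: UNIV_bool)
  finally show ?thesis
    unfolding rho_star_eq_distr by (rule has_bochner_integral_distr[OF g f])
qed

section \<open>The value of the infimum and the optimal pair\<close>

theorem proposition4p5:
  fixes a r l h \<iota> U :: real and w u :: "real \<Rightarrow> real"
  assumes "a > 0" "r > 0" "l > 0" "h > 0"
    and "0 < \<iota>" "\<iota> < 1" "U > 0"
    and "\<And>x. w (- x) = w x"
    and "\<And>x. \<bar>x\<bar> \<le> U \<Longrightarrow> w x = sqrt (r * l) * x\<^sup>2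
           - 2 * a * l * ln (kummer_1F1 ((1 - \<iota>) / 4) (1/2) (sqrt (r / (a\<^sup>2 * l)) * x\<^sup>2))"
    and "\<And>x. \<bar>x\<bar> > U \<Longrightarrow> w x = w U + h * (\<bar>x\<bar> - U)"
    and "(w has_real_derivative h) (at U)"
    and "\<And>x. x \<in> {0..U} \<Longrightarrow> deriv w x \<le> h"
    and "(deriv w has_real_derivative 0) (at U)"
    and "\<And>x. 0 < x \<Longrightarrow> x < U \<Longrightarrow> 0 < deriv w x \<and> deriv w x < h"
    and "\<And>x. u x = - deriv w x / (2 * l)"
  shows "optimal_cost a r l h = ennreal (\<iota> * a * sqrt (r * l)) \<and>
         (\<exists>p. stationary_density a U u p) \<and>
         (\<forall>p. stationary_density a U u p \<longrightarrow>
            (mu_star U u p, rho_star a U p) \<in> admissible a \<and>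
            cost r l h (mu_star U u p) (rho_star a U p) = optimal_cost a r l h)"
proof -
  define I where "I = \<iota> * a * sqrt (r * l)"
  obtain W' W'' where
    dW: "\<And>x. ((\<lambda>x. sqrt (r * l) * x\<^sup>2 - 2 * a * l *
        ln (kummer_1F1 ((1 - \<iota>) / 4) (1/2) (sqrt (r / (a\<^sup>2 * l)) * x\<^sup>2)))
      has_real_derivative W' x) (at x)"
      "\<And>x. (W' has_real_derivative W'' x) (at x)"
    and contW: "continuous_on UNIV W''"
    and odeW: "\<And>x. 1/2 * a * W'' x - (W' x)\<^sup>2 / (4 * l) + r * x\<^sup>2 = I"
    by (rule kummer_value_ode[OF assms(1-3,5,6), folded I_def]) (rule that)
  define w'' where "w'' = (\<lambda>x. if \<bar>x\<bar> \<le> U then W'' x else 0)"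
  note glue = glued_value_C2[OF assms(7-10) dW contW assms(11,13)]
  have dw: "(w has_real_derivative deriv w x) (at x)" "(deriv w has_real_derivative w'' x) (at x)" for x
    using glue(1,2) unfolding w''_def by simp_all
  have contw: "continuous_on UNIV w''"
    using glue(3) unfolding w''_def by simp
  have w'_in: "deriv w x = W' x" if "\<bar>x\<bar> \<le> U" for x
    using glue(4) that by simp
  have w'_out: "deriv w x = h * sgn x" if "\<bar>x\<bar> \<ge> U" for x
    using glue(5) that by simp
  have odd: "deriv w (- x) = - deriv w x" for x
    using glue(6) by simp
  have W''_U: "W'' U = 0"
    using glue(7) by simp
  have w'_U: "deriv w U = h" "deriv w (- U) = - h"
    using w'_out[of U] odd[of U] \<open>U > 0\<close> by auto
  have ode: "1/2 * a * w'' x - (deriv w x)\<^sup>2 / (4 * l) + r * x\<^sup>2 = I" if "x \<in> {-U..U}" for x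
    using odeW[of x] w'_in[of x] that by (simp add: w''_def abs_le_iff)
  have hjb: "I \<le> 1/2 * a * w'' x - (deriv w x)\<^sup>2 / (4 * l) + r * x\<^sup>2" for x
  proof (cases "\<bar>x\<bar> \<le> U")
    case True
    then show ?thesis using ode[of x] by (simp add: abs_le_iff)
  next
    case False
    \<comment> \<open>Outside \<open>[-U, U]\<close> the second derivative is 0 and
      \<open>deriv w\<close> has square \<open>h\<^sup>2\<close>, exactly as at \<open>U\<close>,
      where equality holds. Only the quadratic term changes, and it grows.\<close>
    have "r * U\<^sup>2 \<le> r * x\<^sup>2"
      using False \<open>U > 0\<close> \<open>r > 0\<close> by (intro mult_left_mono) (auto simp: abs_le_square_iff[symmetric])
    moreover have "(deriv w x)\<^sup>2 = h\<^sup>2"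
      using False w'_out[of x] \<open>U > 0\<close> by (cases "x = 0") (auto simp: power_mult_distrib sgn_if)
    ultimately show ?thesis
      using odeW[of U] w'_in[of U] w'_U W''_U False \<open>U > 0\<close> by (simp add: w''_def)
  qed
  \<comment> \<open>Oddness settles the point 0, outside the range \<open>0 < x < U\<close> of the
    hypothesis, and below also the negative half-line.\<close>
  have "deriv w 0 = 0"
    using odd[of 0] by simp
  then have pos_bound: "\<bar>deriv w x\<bar> \<le> h" if "0 \<le> x" for x
    using that assms(14)[of x] w'_out[of x] \<open>h > 0\<close> \<open>U > 0\<close>
    by (cases "x = 0"; cases "x < U") (auto simp: sgn_if)
  have w'_bound: "\<bar>deriv w x\<bar> \<le> h" for x
    using pos_bound[of x] pos_bound[of "- x"] odd[of x] by (cases "0 \<le> x") auto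
  have "bounded (W'' ` {-U..U})"
    using continuous_on_subset[OF contW] by (intro compact_imp_bounded compact_continuous_image) auto
  then have "\<exists>B. \<forall>x\<in>{-U..U}. \<bar>W'' x\<bar> \<le> B"
    unfolding bounded_iff by auto
  then obtain B where B: "\<And>x. x \<in> {-U..U} \<Longrightarrow> \<bar>W'' x\<bar> \<le> B"
    by blast
  \<comment> \<open>\<open>\<bar>B\<bar>\<close> rather than \<open>B\<close> also bounds the value
    0 taken outside the interval.\<close>
  have w''_bound: "\<bar>w'' x\<bar> \<le> \<bar>B\<bar>" for x
    using B[of x] by (auto simp: w''_def abs_le_iff)
  have lower: "ennreal I \<le> cost r l h \<mu> \<rho>" if "(\<mu>, \<rho>) \<in> admissible a" for \<mu> \<rho>
    using cost_lower_bound[OF that dw contw w'_bound w''_bound] assms(2,3) hjb by simp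
  have u_eq: "u = (\<lambda>x. - deriv w x / (2 * l))"
    using assms(15) by auto
  define V where "V = (\<lambda>x. - w x / (2 * l))"
  define u' where "u' = (\<lambda>x. - w'' x / (2 * l))"
  have dV: "(V has_real_derivative u x) (at x)" for x
    unfolding V_def u_eq by (intro DERIV_cdivide DERIV_minus dw)
  have du: "(u has_real_derivative u' x) (at x)" for x
    unfolding u'_def u_eq by (intro DERIV_cdivide DERIV_minus dw)
  have contu': "continuous_on UNIV u'"
    unfolding u'_def using \<open>l > 0\<close> by (intro continuous_intros contw) auto
  have contu: "continuous_on S u" for S
    using du by (auto intro!: DERIV_isCont continuous_at_imp_continuous_on)
  have u_meas: "u \<in> borel_measurable borel"
    using contu by (rule borel_measurable_continuous_onI)
  have optimal: "(mu_star U u p, rho_star a U p) \<in> admissible a \<and>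
      cost r l h (mu_star U u p) (rho_star a U p) = ennreal I" if st: "stationary_density a U u p" for p
  proof -
    have p_nonneg: "0 \<le> p x" if "x \<in> {-U..U}" for x
      using stationary_density_nonneg[OF st _ _ dV du that] \<open>U > 0\<close> \<open>a > 0\<close> by simp
    have "u differentiable (at x)" for x
      using du by (auto simp: real_differentiable_def)
    then obtain p' where
      dp: "\<And>x. x \<in> {-U..U} \<Longrightarrow> (p has_real_derivative p' x) (at x within {-U..U})"
      and flux: "\<And>x. x \<in> {-U..U} \<Longrightarrow> 1/2 * a * p' x = u x * p x"
      using stationary_density_zero_flux[OF st \<open>U > 0\<close> contu] by metis
    have contp: "continuous_on {-U..U} p"
      by (rule DERIV_continuous_on[OF dp])
    have int: "(p has_integral 1) {-U..U}"
      using st by (auto simp: stationary_density_def)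
    have ap: "0 \<le> a * p (-U)" "0 \<le> a * p U"
      using p_nonneg \<open>a > 0\<close> \<open>U > 0\<close> by auto
    note mu = has_bochner_integral_mu_star[OF \<open>U > 0\<close> contp p_nonneg u_meas]
    note rho = has_bochner_integral_rho_star[where p = p, OF ap]
    text \<open>Under zero flux, \<open>(a/2) g p\<close> is a primitive of \<open>p\<close> times the generator applied to a
      primitive of \<open>g\<close>. This yields both the constraint (\<open>g = f'\<close>) and the cost (\<open>g = w'\<close>).\<close>
    have d_gp: "((\<lambda>x. 1/2 * a * (g x * p x)) has_real_derivative p x * (1/2 * a * D + u x * g x))
        (at x within {-U..U})" if "(g has_real_derivative D) (at x)" "x \<in> {-U..U}" for g D x
    proof -
      have "1/2 * a * (D * p x + p' x * g x) = p x * (1/2 * a * D) + g x * (1/2 * a * p' x)"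
        by (simp add: algebra_simps)
      also have "\<dots> = p x * (1/2 * a * D + u x * g x)"
        unfolding flux[OF that(2)] by (simp add: algebra_simps)
      finally have eq: "1/2 * a * (D * p x + p' x * g x) = p x * (1/2 * a * D + u x * g x)" .
      show ?thesis
        unfolding eq[symmetric]
        by (intro DERIV_cmult DERIV_mult has_field_derivative_at_within[OF that(1)] dp that(2))
    qed
    have rho_meas: "(\<lambda>(x, \<gamma>, \<delta>). f x \<gamma>) \<in> borel_measurable jump_space"
      if "case_prod f \<in> borel_measurable (borel \<Otimes>\<^sub>M borel)" for f :: "real \<Rightarrow> real \<Rightarrow> real"
    proof -
      have "(\<lambda>q :: real \<times> real \<times> real. case_prod f (fst q, fst (snd q)))
          \<in> borel_measurable (borel \<Otimes>\<^sub>M borel \<Otimes>\<^sub>M borel)"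
        by (rule measurable_compose[OF _ that]) measurable
      then show ?thesis
        unfolding jump_space_def
        by (intro measurable_restrict_space1) (simp add: borel_prod case_prod_unfold)
    qed
    have "finite_measure (rho_star a U p)"
    proof (rule finite_measureI)
      have "integrable (rho_star a U p) (\<lambda>_. 1 :: real)"
        using rho[of "\<lambda>_. 1"] by (simp add: has_bochner_integral_iff)
      then show "emeasure (rho_star a U p) (space (rho_star a U p)) \<noteq> \<infinity>"
        by (simp add: integrable_iff_bounded)
    qed
    moreover have "integrable (mu_star U u p) (\<lambda>(x, u). 1/2 * a * deriv (deriv f) x + u * deriv f x) \<and>
        integrable (rho_star a U p) (\<lambda>(x, \<gamma>, \<delta>). \<gamma> * deriv f x) \<and>
        (\<integral>(x, u). 1/2 * a * deriv (deriv f) x + u * deriv f x \<partial>mu_star U u p)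
          + (\<integral>(x, \<gamma>, \<delta>). \<gamma> * deriv f x \<partial>rho_star a U p) = 0" if f: "f \<in> C2_0" for f
    proof -
      have df: "(deriv f has_real_derivative deriv (deriv f) x) (at x)" for x
        using f by (auto simp: C2_0_def field_differentiable_derivI DERIV_deriv_iff_field_differentiable)
      have contf: "continuous_on S (deriv f)" for S
        using df by (auto intro!: DERIV_isCont continuous_at_imp_continuous_on)
      have contf': "continuous_on S (deriv (deriv f))" for S
        using f continuous_on_subset[of UNIV "deriv (deriv f)" S] by (simp add: C2_0_def)
      have meas[measurable]: "deriv f \<in> borel_measurable borel" "deriv (deriv f) \<in> borel_measurable borel"
        by (rule borel_measurable_continuous_onI[OF contf] borel_measurable_continuous_onI[OF contf'])+
      \<comment> \<open>Only boundary terms remain; the inward jumps with masses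
        \<open>1/2 * a * p (-U)\<close> and \<open>1/2 * a * p U\<close> cancel exactly
        these.\<close>
      have "has_bochner_integral (mu_star U u p) (\<lambda>(x, u). 1/2 * a * deriv (deriv f) x + u * deriv f x)
          (1/2 * a * (deriv f U * p U) - 1/2 * a * (deriv f (-U) * p (-U)))"
      proof (rule mu)
        show "(\<lambda>(x, u). 1/2 * a * deriv (deriv f) x + u * deriv f x) \<in> borel_measurable borel"
          unfolding borel_prod[symmetric] by measurable
        show "continuous_on {-U..U} (\<lambda>x. (\<lambda>(x, u). 1/2 * a * deriv (deriv f) x + u * deriv f x) (x, u x))"
          using contf contf' contu by (auto intro!: continuous_intros)
        fix x assume x: "x \<in> {-U..U}"
        show "((\<lambda>x. 1/2 * a * (deriv f x * p x)) has_real_derivative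
          p x * (\<lambda>(x, u). 1/2 * a * deriv (deriv f) x + u * deriv f x) (x, u x)) (at x within {-U..U})"
          using d_gp[OF df[of x] x] unfolding case_prod_conv .
      qed
      moreover have "has_bochner_integral (rho_star a U p) (\<lambda>(x, \<gamma>, \<delta>). \<gamma> * deriv f x)
          (1/2 * a * p (-U) * deriv f (-U) - 1/2 * a * p U * deriv f U)"
        using rho[OF rho_meas[of "\<lambda>x \<gamma>. \<gamma> * deriv f x"]] by simp
      ultimately show ?thesis
        by (simp add: has_bochner_integral_iff algebra_simps)
    qed
    moreover have "prob_space (mu_star U u p)"
      by (rule prob_space_mu_star[OF \<open>U > 0\<close> contp p_nonneg u_meas int])
    ultimately have adm: "(mu_star U u p, rho_star a U p) \<in> admissible a"
      by (simp add: admissible_def mu_star_def rho_star_def)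
    define P where "P = (\<lambda>x. integral {-U..x} p)"
    have dP: "(P has_real_derivative p x) (at x within {-U..U})" if "x \<in> {-U..U}" for x
      unfolding P_def using contp that by (rule integral_has_real_derivative)
    \<comment> \<open>A primitive of \<open>p\<close> times the running cost: under \<open>u\<close>
      this cost equals \<open>I\<close> minus the generator applied to \<open>w\<close>, and
      \<open>d_gp\<close> integrates the generator term.\<close>
    define F where "F = (\<lambda>x. I * P x - 1/2 * a * (deriv w x * p x))"
    have cost_x: "has_bochner_integral (mu_star U u p) (\<lambda>(x, u). r * x\<^sup>2 + l * u\<^sup>2) (F U - F (- U))"
    proof (rule mu)
      show "(\<lambda>(x, u). r * x\<^sup>2 + l * u\<^sup>2) \<in> borel_measurable borel"
        unfolding borel_prod[symmetric] by measurable
      show "continuous_on {-U..U} (\<lambda>x. (\<lambda>(x, u). r * x\<^sup>2 + l * u\<^sup>2) (x, u x))"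
        by (auto intro!: continuous_intros contu)
      fix x assume x: "x \<in> {-U..U}"
      \<comment> \<open>These identities express the equality case of the completed square in the
        lower bound.\<close>
      have "l * (u x)\<^sup>2 = (deriv w x)\<^sup>2 / (4 * l)"
        "u x * deriv w x = - (2 * ((deriv w x)\<^sup>2 / (4 * l)))"
        using \<open>l > 0\<close> by (simp_all add: assms(15) power2_eq_square)
      then have rate: "r * x\<^sup>2 + l * (u x)\<^sup>2 = I - (1/2 * a * w'' x + u x * deriv w x)"
        using ode[OF x] by linarith
      have eq: "I * p x - p x * (1/2 * a * w'' x + u x * deriv w x)
          = p x * (\<lambda>(x, u). r * x\<^sup>2 + l * u\<^sup>2) (x, u x)"
        unfolding case_prod_conv rate by (simp add: algebra_simps)
      show "(F has_real_derivative p x * (\<lambda>(x, u). r * x\<^sup>2 + l * u\<^sup>2) (x, u x)) (at x within {-U..U})"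
        using DERIV_diff[OF DERIV_cmult[OF dP[OF x], of I] d_gp[OF dw(2) x]] unfolding F_def eq .
    qed
    have cost_\<gamma>: "has_bochner_integral (rho_star a U p) (\<lambda>(x, \<gamma>, \<delta>). h * \<bar>\<gamma>\<bar>)
        (1/2 * a * h * (p U + p (- U)))"
      using rho[OF rho_meas[of "\<lambda>x \<gamma>. h * \<bar>\<gamma>\<bar>"]] by (simp add: algebra_simps add_divide_distrib)
    have "(\<integral>\<^sup>+q. ennreal ((\<lambda>(x, u). r * x\<^sup>2 + l * u\<^sup>2) q) \<partial>mu_star U u p) = ennreal (F U - F (- U))"
      using cost_x assms(2,3) by (subst nn_integral_eq_integral) (auto simp: has_bochner_integral_iff)
    moreover have "(\<integral>\<^sup>+q. ennreal ((\<lambda>(x, \<gamma>, \<delta>). h * \<bar>\<gamma>\<bar>) q) \<partial>rho_star a U p)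
        = ennreal (1/2 * a * h * (p U + p (- U)))"
      using integrable.intros[OF cost_\<gamma>] assms(4)
      by (subst nn_integral_eq_integral) (auto simp: has_bochner_integral_integral_eq[OF cost_\<gamma>])
    ultimately have "cost r l h (mu_star U u p) (rho_star a U p)
        = ennreal (F U - F (- U)) + ennreal (1/2 * a * h * (p U + p (- U)))"
      unfolding cost_def by (simp only: case_prod_unfold)
    \<comment> \<open>Additivity of \<open>ennreal\<close> requires nonnegative summands; the first
      one is nonnegative as the integral of the running cost.\<close>
    also have "\<dots> = ennreal (F U - F (- U) + 1/2 * a * h * (p U + p (- U)))"
    proof (rule ennreal_plus[symmetric])
      have "0 \<le> (\<integral>(x, u). r * x\<^sup>2 + l * u\<^sup>2 \<partial>mu_star U u p)"
        using assms(2,3) by (intro Bochner_Integration.integral_nonneg) auto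
      then show "0 \<le> F U - F (- U)"
        using cost_x by (simp add: has_bochner_integral_iff)
      show "0 \<le> 1/2 * a * h * (p U + p (- U))"
        using p_nonneg assms(1,4,7) by simp
    qed
    \<comment> \<open>As \<open>deriv w\<close> equals \<open>h\<close> at \<open>U\<close> and
      \<open>- h\<close> at \<open>-U\<close>, the boundary terms of \<open>F\<close> cancel the
      jump cost, leaving \<open>I\<close> times the unit mass of \<open>p\<close>.\<close>
    also have "F U - F (- U) + 1/2 * a * h * (p U + p (- U)) = I"
      using integral_unique[OF int] unfolding F_def P_def w'_U by (simp add: algebra_simps)
    finally have "cost r l h (mu_star U u p) (rho_star a U p) = ennreal I" .
    with adm show ?thesis by blast
  qed
  have ex: "\<exists>p. stationary_density a U u p"
    using stationary_density_exists[OF _ _ dV du contu'] \<open>U > 0\<close> \<open>a > 0\<close> by simp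
  then obtain p where p: "stationary_density a U u p" ..
  \<comment> \<open>Any stationary density gives an admissible pair of cost \<open>I\<close>, so the
    existence of one supplies the upper bound.\<close>
  have "optimal_cost a r l h = ennreal I"
  proof (rule antisym)
    show "optimal_cost a r l h \<le> ennreal I"
      unfolding optimal_cost_def using optimal[OF p]
      by (intro INF_lower2[of "(mu_star U u p, rho_star a U p)"]) auto
    show "ennreal I \<le> optimal_cost a r l h"
      unfolding optimal_cost_def using lower by (intro INF_greatest) auto
  qed
  with ex optimal show ?thesis
    unfolding I_def by simp
qed

end
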